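(* Let $n\in\mathbb{N}$ and let $\sigma$ be a probability distribution on $[n]=\{1,\dots,n\}$ such that $\sigma_{\le i}>\tfrac{i}{n}$ for every $i\in[n-1]$. Consider the $\sigma$-MultiQueue and let $(r_1^{(s)},\dots,r_n^{(s)})$ be the ranks of its top-elements after $s$ deletions. Then, as $s\to\infty$, $(r_1^{(s)},\dots,r_n^{(s)})$ converges in distribution to the random vector $(r_1,\dots,r_n)$ defined by \[ r_i = 1+\sum_{j=1}^{i-1}\delta_j \quad (i\in[n]),\] where $\delta_1,\dots,\delta_{n-1}$ are independent random variables with $\delta_i\sim \mathrm{Geom}_1\!\left(1-\frac{i}{n\,\sigma_{\le i}}\right)$ for $i\in[n-1]$.
   Context: For a probability distribution $\sigma$ on $[n]$ write $\sigma_i=\Pr_{i^*\sim\sigma}[i^*=i]$ and $\sigma_{\le i}=\Pr_{i^*\sim\sigma}[i^*\le i]$. The $\sigma$-MultiQueue: take an infinite totally ordered set of elements $x_1<x_2<x_3<\cdots$ and assign each element independently and uniformly at random to one of $n$ priority queues. The queues (identified with the sets of elements they contain) are labelled $Q_1,\dots,Q_n$ so that $\min Q_1<\min Q_2<\dots<\min Q_n$; these minima are the top-elements. A deletion samples $i\sim\sigma$ (independently of everything else), removes $\min Q_i$ from $Q_i$, and then relabels the queues so that their top-elements are again in increasing order. After $s$ deletions the queues are $Q_1^{(s)},\dots,Q_n^{(s)}$, and $r_i^{(s)}$ denotes the rank of $\min Q_i^{(s)}$ within $Q_1^{(s)}\cup\dots\cup Q_n^{(s)}$ (the smallest element has rank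 $1$). $\mathrm{Geom}_1(p)$ denotes the distribution of the number of independent Bernoulli($p$) trials up to and including the first success (support $\{1,2,\dots\}$). *)

theory Defs
  imports "HOL-Probability.Probability"
begin

text \<open>Model of the sigma-MultiQueue. The elements x_1 < x_2 < ... are identified with
  the natural numbers k (ordered as usual). An assignment a :: nat => nat sends element k
  to physical queue a k in {1..n}. A state is the (finite) set D of already deleted elements.\<close>

definition mq_top :: "(nat \<Rightarrow> nat) \<Rightarrow> nat set \<Rightarrow> nat \<Rightarrow> nat" where
  "mq_top a D q = (LEAST k. k \<notin> D \<and> a k = q)"

text \<open>Top elements sorted increasingly; entry i-1 is min Q_i (labelled queue i).\<close>
definition mq_tops :: "nat \<Rightarrow> (nat \<Rightarrow> nat) \<Rightarrow> nat set \<Rightarrow> nat list" where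
  "mq_tops n a D = sorted_list_of_set (mq_top a D ` {1..n})"

text \<open>Deleted set after s deletions; c s in {1..n} is the label sampled at deletion s+1.\<close>
primrec mq_deleted :: "nat \<Rightarrow> (nat \<Rightarrow> nat) \<Rightarrow> (nat \<Rightarrow> nat) \<Rightarrow> nat \<Rightarrow> nat set" where
  "mq_deleted n a c 0 = {}"
| "mq_deleted n a c (Suc s) =
     insert (mq_tops n a (mq_deleted n a c s) ! (c s - 1)) (mq_deleted n a c s)"

definition mq_rank :: "nat \<Rightarrow> (nat \<Rightarrow> nat) \<Rightarrow> nat set \<Rightarrow> nat \<Rightarrow> nat" where
  "mq_rank n a D i = card {k. k \<notin> D \<and> k \<le> mq_tops n a D ! (i - 1)}"

definition mq_ranks :: "nat \<Rightarrow> (nat \<Rightarrow> nat) \<Rightarrow> (nat \<Rightarrow> nat) \<Rightarrow> nat \<Rightarrow> nat list" where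
  "mq_ranks n a c s = map (mq_rank n a (mq_deleted n a c s)) [1..<n+1]"

text \<open>Underlying probability space: coordinate k is the pair (queue of element k,
  label sampled at deletion k+1), all independent; assignments uniform on {1..n},
  labels distributed according to sigma.\<close>
definition mq_space :: "nat \<Rightarrow> nat pmf \<Rightarrow> (nat \<Rightarrow> nat \<times> nat) measure" where
  "mq_space n \<sigma> = PiM UNIV (\<lambda>_. measure_pmf (pair_pmf (pmf_of_set {1..n}) \<sigma>))"

definition sigma_le :: "nat pmf \<Rightarrow> nat \<Rightarrow> real" where
  "sigma_le \<sigma> i = measure_pmf.prob \<sigma> {1..i}"

text \<open>Geom_1(p): number of Bernoulli(p) trials up to and including the first success.\<close>
definition geom1_pmf :: "real \<Rightarrow> nat pmf" where
  "geom1_pmf p = map_pmf Suc (geometric_pmf p)"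

definition mq_limit :: "nat \<Rightarrow> nat pmf \<Rightarrow> nat list pmf" where
  "mq_limit n \<sigma> =
     map_pmf (\<lambda>\<delta>. map (\<lambda>i. 1 + (\<Sum>j\<in>{1..<i}. \<delta> j)) [1..<n+1])
       (Pi_pmf {1..<n} 0 (\<lambda>j. geom1_pmf (1 - real j / (real n * sigma_le \<sigma> j))))"

end

theory Submission
  imports Defs
begin

text \<open>Record the state by the sequence \<open>b\<close> of queue labels of the remaining elements in increasing
  order; a deletion removes the position of the \<open>i\<close>-th label to appear for the first time. The ranks
  are read off the set \<open>J\<close> of positions of first appearances. Relative to the i.i.d. uniform
  law of \<open>b\<close>, the law after any number of deletions has a density that depends on \<open>J\<close> only, since
  the adjoint of a deletion inserts a fresh label, at a position \<open>p\<close>, in front of its first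
  appearance \<open>f\<close>. This adjoint fixes the density \<open>1 / weight J\<close>, where \<open>weight J\<close> is the product of
  \<open>\<sigma>\<^sub>\<le>\<^sub>c\<close> over the positions \<open>0 < k \<le> Max J\<close> and \<open>c\<close> is the number of labels seen
  before \<open>k\<close>: the sum over \<open>p\<close> telescopes. Normalized, it is the asserted product of geometric laws.

  Since \<open>weight \<le> 1\<close>, the density of the initial law relative to the stationary one is bounded. Its
  iterates under the reversed kernel have decreasing second moments, so the conditional variances
  tend to 0 and the iterates agree asymptotically along every reversed transition of positive
  probability. Repeatedly inserting, at the front, the label that appears last leads from every state to
  \<open>{..<n}\<close> in \<open>n\<close> steps, which forces the iterates to converge to a constant. Dominated
  convergence finishes the proof.\<close>

section \<open>Convergence of a Markov operator with a common absorbing path\<close>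

lemma integral_bind_pmf_bounded:
  fixes f :: "'b \<Rightarrow> real"
  assumes "\<And>y. \<bar>f y\<bar> \<le> B"
  shows "measure_pmf.expectation (bind_pmf p k) f
       = measure_pmf.expectation p (\<lambda>x. measure_pmf.expectation (k x) f)"
  unfolding measure_pmf_bind
  by (rule integral_bind[where K = "count_space UNIV" and B' = 1 and B = B])
     (use assms measurable_measure_pmf[of k] in \<open>auto simp: measure_pmf.emeasure_space_1[simplified]\<close>)

lemma integrable_atom: "integrable (measure_pmf p) (\<lambda>y. indicator {u} y * (c :: real))"
  by (rule measure_pmf.integrable_const_bound[where B = "\<bar>c\<bar>"]) (auto simp: indicator_def)

text \<open>The variance is the mean squared deviation, and the atom \<open>u\<close> alone already
  contributes the left-hand side. Small variance thereby gives pointwise control at every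
  atom.\<close>

lemma pmf_variance_ge_atom:
  fixes g :: "'a \<Rightarrow> real" and p :: "'a pmf"
  assumes "\<And>y. \<bar>g y\<bar> \<le> B"
  defines "m \<equiv> measure_pmf.expectation p g"
  shows "pmf p u * (g u - m)\<^sup>2 \<le> measure_pmf.expectation p (\<lambda>y. (g y)\<^sup>2) - m\<^sup>2"
proof -
  have int [simp]: "integrable (measure_pmf p) g"
    by (rule measure_pmf.integrable_const_bound[where B = B]) (use assms in auto)
  have int2 [simp]: "integrable (measure_pmf p) (\<lambda>y. (g y)\<^sup>2)"
    by (rule measure_pmf.integrable_const_bound[where B = "B\<^sup>2"])
       (use assms in \<open>auto simp: abs_le_square_iff[symmetric] intro: order_trans[OF _ abs_ge_self]\<close>)
  have "pmf p u * (g u - m)\<^sup>2 = (\<integral>y. indicator {u} y * (g u - m)\<^sup>2 \<partial>measure_pmf p)"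
    by (simp add: measure_pmf_single)
  also have "\<dots> \<le> (\<integral>y. (g y - m)\<^sup>2 \<partial>measure_pmf p)"
    by (rule integral_mono[OF integrable_atom]) (simp add: power2_diff, simp add: indicator_def)
  also have "\<dots> = measure_pmf.expectation p (\<lambda>y. (g y)\<^sup>2) - m\<^sup>2"
    using measure_pmf.variance_eq[of p g] by (simp add: m_def)
  finally show ?thesis by simp
qed

text \<open>Second moments under \<pi> drop in each step by the mean conditional variance, so these
  variances tend to 0 and no transition of positive probability sees an asymptotic difference.
  Following \<open>U\<close> for \<open>N\<close> steps ties every \<open>h (s + N) x\<close> to the
  single value \<open>h s z\<close>. A common \<open>N\<close> forces \<open>U\<close> to fix
  \<open>z\<close>, which excludes periodicity.\<close>

theorem markov_iterates_converge:
  fixes \<pi> :: "'a pmf" and \<kappa> :: "'a \<Rightarrow> 'a pmf" and h :: "nat \<Rightarrow> 'a \<Rightarrow> real"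
  assumes inv: "bind_pmf \<pi> \<kappa> = \<pi>"
    and bnd: "\<And>x. \<bar>h 0 x\<bar> \<le> C"
    and step: "\<And>s x. h (Suc s) x = measure_pmf.expectation (\<kappa> x) (h s)"
    and U: "\<And>x. x \<in> set_pmf \<pi> \<Longrightarrow> U x \<in> set_pmf (\<kappa> x)"
    and N: "\<And>x. x \<in> set_pmf \<pi> \<Longrightarrow> (U ^^ N) x = z"
    and x: "x \<in> set_pmf \<pi>"
  shows "(\<lambda>s. h s x) \<longlonglongrightarrow> measure_pmf.expectation \<pi> (h 0)"
proof -
  have bnd': "\<bar>h s x\<bar> \<le> C" for s x
  proof (induction s arbitrary: x)
    case (Suc s)
    have *: "integrable (measure_pmf (\<kappa> x)) (h s)"
      by (rule measure_pmf.integrable_const_bound[where B = C]) (use Suc in auto)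
    have "measure_pmf.expectation (\<kappa> x) (h s) \<le> C" "- C \<le> measure_pmf.expectation (\<kappa> x) (h s)"
      using Suc * by (auto intro!: measure_pmf.integral_le_const measure_pmf.integral_ge_const AE_I2 
           simp: abs_le_iff minus_le_iff)
    then show ?case by (simp add: step abs_le_iff)
  qed (rule bnd)
  have bnd2: "\<bar>(h s x)\<^sup>2\<bar> \<le> C\<^sup>2" for s x
    using bnd'[of s x] by (simp add: abs_le_square_iff[symmetric])
  have int [simp]: "integrable (measure_pmf p) (h s)" "integrable (measure_pmf p) (\<lambda>y. (h s y)\<^sup>2)" for p s
    by (rule measure_pmf.integrable_const_bound[where B = C],
        use bnd' in auto, rule measure_pmf.integrable_const_bound[where B = "C\<^sup>2"], use bnd2 in auto)
  have mean: "measure_pmf.expectation \<pi> (h s) = measure_pmf.expectation \<pi> (h 0)" for s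
  proof (induction s)
    case (Suc s)
    then show ?case
      using integral_bind_pmf_bounded[of "h s" C \<pi> \<kappa>] bnd' by (simp add: inv step[abs_def])
  qed simp
  \<comment> \<open>\<open>V s\<close> is the second moment of \<open>h s\<close> under \<pi>, and
    \<open>v s x\<close> is the variance of \<open>h s\<close> after one step from \<open>x\<close>.
    Invariance of \<pi> gives that the mean of \<open>v s\<close> is
    \<open>V s - V (Suc s)\<close>.\<close>
  define V where "V s = measure_pmf.expectation \<pi> (\<lambda>y. (h s y)\<^sup>2)" for s
  define v where "v s x = measure_pmf.expectation (\<kappa> x) (\<lambda>y. (h s y)\<^sup>2) - (h (Suc s) x)\<^sup>2" for s x
  have v_ge: "pmf (\<kappa> x) u * (h s u - h (Suc s) x)\<^sup>2 \<le> v s x" for s x u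
    unfolding v_def step by (rule pmf_variance_ge_atom[OF bnd'])
  have v_nonneg: "0 \<le> v s x" for s x
    by (rule order_trans[OF _ v_ge]) auto
  have int3: "integrable (measure_pmf \<pi>) (\<lambda>x. measure_pmf.expectation (\<kappa> x) (\<lambda>y. (h s y)\<^sup>2))" for s
  proof (rule measure_pmf.integrable_const_bound[where B = "C\<^sup>2"])
    have "measure_pmf.expectation (\<kappa> x) (\<lambda>y. (h s y)\<^sup>2) \<le> C\<^sup>2" for x
      using bnd2 by (intro measure_pmf.integral_le_const) auto
    then show "AE x in \<pi>. norm (measure_pmf.expectation (\<kappa> x) (\<lambda>y. (h s y)\<^sup>2)) \<le> C\<^sup>2"
      by (auto simp: integral_nonneg_AE)
  qed simp
  then have v_int: "integrable (measure_pmf \<pi>) (v s)" for s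
    unfolding v_def[abs_def] by simp
  have V_diff: "measure_pmf.expectation \<pi> (v s) = V s - V (Suc s)" for s
    using integral_bind_pmf_bounded[of "\<lambda>y. (h s y)\<^sup>2" "C\<^sup>2" \<pi> \<kappa>] bnd2 int3[of s]
    by (simp add: v_def[abs_def] V_def inv)
  have "decseq V"
    by (rule decseq_SucI) (use V_diff v_nonneg integral_nonneg_AE[of "v _" "measure_pmf \<pi>"] in \<open>fastforce\<close>)
  moreover have "0 \<le> V s" for s
    by (simp add: V_def)
  ultimately obtain L where "V \<longlonglongrightarrow> L"
    using decseq_convergent by blast
  then have V0: "(\<lambda>s. V s - V (Suc s)) \<longlonglongrightarrow> 0"
    using tendsto_diff[OF _ LIMSEQ_Suc, of V L V L] by simp
  have one_step: "(\<lambda>s. h (Suc s) x - h s (U x)) \<longlonglongrightarrow> 0" if "x \<in> set_pmf \<pi>" for x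
  proof -
    \<comment> \<open>\<open>w\<close> is the stationary probability of the transition from
      \<open>x\<close> to \<open>U x\<close>; this single transition already contributes the squared
      difference times \<open>w\<close> to the mean of \<open>v s\<close>.\<close>
    define w where "w = pmf \<pi> x * pmf (\<kappa> x) (U x)"
    have w: "w > 0" using that U[OF that] by (simp add: w_def pmf_positive)
    have le: "w * (h (Suc s) x - h s (U x))\<^sup>2 \<le> V s - V (Suc s)" for s
    proof -
      have "w * (h (Suc s) x - h s (U x))\<^sup>2 = pmf \<pi> x * (pmf (\<kappa> x) (U x) * (h s (U x) - h (Suc s) x)\<^sup>2)"
        by (simp add: w_def power2_commute)
      also have "\<dots> \<le> pmf \<pi> x * v s x"
        by (intro mult_left_mono v_ge) auto
      also have "\<dots> = (\<integral>y. indicator {x} y * v s x \<partial>measure_pmf \<pi>)"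
        by (simp add: measure_pmf_single)
      also have "\<dots> \<le> measure_pmf.expectation \<pi> (v s)"
        by (rule integral_mono[OF integrable_atom]) (use v_nonneg v_int in \<open>auto simp: indicator_def\<close>)
      finally show ?thesis by (simp add: V_diff)
    qed
    have "(\<lambda>s. (V s - V (Suc s)) / w) \<longlonglongrightarrow> 0"
      using tendsto_divide_zero[OF V0] .
    then have "(\<lambda>s. (h (Suc s) x - h s (U x))\<^sup>2) \<longlonglongrightarrow> 0"
      by (rule tendsto_sandwich[OF _ _ tendsto_const, rotated 2])
         (use le w in \<open>auto simp: field_simps\<close>)
    then show ?thesis by simp
  qed
  have Uin: "U x \<in> set_pmf \<pi>" if "x \<in> set_pmf \<pi>" for x
    using U[OF that] that inv by (metis UN_I set_bind_pmf)
  have many: "(\<lambda>s. h (s + m) x - h s ((U ^^ m) x)) \<longlonglongrightarrow> 0" if "x \<in> set_pmf \<pi>" for x m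
    using that
  proof (induction m arbitrary: x)
    case (Suc m)
    have "(\<lambda>s. (h (Suc (s + m)) x - h (s + m) (U x)) + (h (s + m) (U x) - h s ((U ^^ m) (U x)))) \<longlonglongrightarrow> 0 + 0"
      by (intro tendsto_add LIMSEQ_ignore_initial_segment[OF one_step] Suc.IH Uin Suc.prems)
    then show ?case by (simp add: funpow_swap1)
  qed simp
  have lim: "(\<lambda>s. h (s + N) x - h s z) \<longlonglongrightarrow> 0" if "x \<in> set_pmf \<pi>" for x
    using many[OF that, of N] N[OF that] by simp
  \<comment> \<open>Averaging over \<open>x\<close> identifies the limit: the mean of
    \<open>h (s + N)\<close> is constant in \<open>s\<close>, hence \<open>h s z\<close> must
    converge to it.\<close>
  have "(\<lambda>s. measure_pmf.expectation \<pi> (\<lambda>x. h (s + N) x - h s z)) \<longlonglongrightarrow> measure_pmf.expectation \<pi> (\<lambda>x. 0)"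
  proof (rule integral_dominated_convergence[where w = "\<lambda>_. 2 * C"])
    have "\<bar>h (s + N) x - h s z\<bar> \<le> 2 * C" for s x
      using bnd'[of "s + N" x] bnd'[of s z] by linarith
    then show "AE x in \<pi>. norm (h (s + N) x - h s z) \<le> 2 * C" for s by simp
  qed (use lim in \<open>auto simp: AE_measure_pmf_iff\<close>)
  then have "(\<lambda>s. measure_pmf.expectation \<pi> (h 0) - h s z) \<longlonglongrightarrow> 0"
    by (simp add: mean[of "s + N" for s])
  from tendsto_diff[OF lim[OF x] this]
  have "(\<lambda>s. (h (s + N) x - measure_pmf.expectation \<pi> (h 0))) \<longlonglongrightarrow> 0" by simp
  then show ?thesis
    by (rule LIMSEQ_offset[OF LIM_zero_cancel])
qed

section \<open>Reversed dynamics on sets of top positions\<close>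

text \<open>When \<open>J\<close> consists of the first appearances in a label sequence, this is the
  number of distinct labels seen before position \<open>k\<close>. A top at \<open>k\<close>
  therefore belongs to the queue with label \<open>Suc (before J k)\<close>.\<close>

definition before :: "nat set \<Rightarrow> nat \<Rightarrow> nat" where
  "before J k = card (J \<inter> {..<k})"

text \<open>First appearances after inserting at \<open>p \<le> f\<close> a copy of the label that first appears at \<open>f\<close>.\<close>

definition pushed :: "nat set \<Rightarrow> nat \<Rightarrow> nat \<Rightarrow> nat set" where
  "pushed J p f = insert p (J \<inter> {..<p} \<union> Suc ` (J \<inter> {p..} - {f}))"

text \<open>The state space: position 0 is always a top, because the smallest remaining element
  heads its queue.\<close>

definition top_sets :: "nat \<Rightarrow> nat set set" where
  "top_sets n = {J. finite J \<and> card J = n \<and> 0 \<in> J}"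

lemma countable_top_sets: "countable (top_sets n)"
  by (rule countable_subset[OF _ countable_Collect_finite]) (auto simp: top_sets_def)

lemma before_0 [simp]: "before J 0 = 0"
  by (simp add: before_def)

lemma before_pos: "0 \<in> J \<Longrightarrow> 0 < k \<Longrightarrow> 0 < before J k"
  by (auto simp: before_def card_gt_0_iff)

lemma before_le_card: "finite J \<Longrightarrow> before J k \<le> card J"
  by (auto simp: before_def intro: card_mono)

lemma before_less_card: "finite J \<Longrightarrow> f \<in> J \<Longrightarrow> k \<le> f \<Longrightarrow> before J k < card J"
  unfolding before_def by (rule psubset_card_mono) (simp, rule psubsetI, blast, metis IntD2 lessThan_iff not_less)

lemma before_Max: "finite J \<Longrightarrow> Max J < k \<Longrightarrow> before J k = card J"
  by (cases "J = {}") (auto simp: before_def intro!: arg_cong[where f = card])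

lemma before_pushed_low: "k \<le> p \<Longrightarrow> before (pushed J p f) k = before J k"
  by (auto simp: before_def pushed_def intro!: arg_cong[where f = card])

text \<open>Past \<open>p\<close> all old positions move up by one. The new top \<open>p\<close>
  adds one to the count until the old top \<open>f\<close> has been passed, whose loss cancels
  it.\<close>

lemma before_pushed_high:
  assumes "f \<in> J" "p \<le> f" "p \<le> m"
  shows "before (pushed J p f) (Suc m) = (if m \<le> f then Suc (before J m) else before J m)"
proof -
  define A where "A = J \<inter> {p..<m}"
  have fin: "finite A" by (simp add: A_def)
  have "pushed J p f \<inter> {..<Suc m} = insert p (J \<inter> {..<p} \<union> Suc ` (A - {f}))"
    using assms by (auto simp: pushed_def A_def)
  moreover have "card (insert p (J \<inter> {..<p} \<union> Suc ` (A - {f}))) = Suc (card (J \<inter> {..<p}) + card (A - {f}))"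
    by (subst card_insert_disjoint, use fin in simp, force simp: A_def, subst card_Un_disjoint)
       (use fin in \<open>auto simp: A_def card_image\<close>)
  moreover have "card (J \<inter> {..<m}) = card (J \<inter> {..<p}) + card A"
    using assms by (subst card_Un_disjoint[symmetric]) (auto simp: A_def intro!: arg_cong[where f = card])
  moreover have "card (A - {f}) = (if m \<le> f then card A else card A - 1)" "m > f \<Longrightarrow> 0 < card A"
    using assms fin by (auto simp: A_def card_Diff_singleton_if card_gt_0_iff)
  ultimately show ?thesis by (auto simp: before_def)
qed

lemma Max_pushed_le:
  assumes "finite J" "f \<in> J" "p \<le> f"
  shows "Max (pushed J p f) \<le> Suc (Max J)"
proof (rule Max.boundedI)
  fix x assume "x \<in> pushed J p f"
  then consider "x = p" | "x \<in> J" | y where "x = Suc y" "y \<in> J"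
    by (auto simp: pushed_def)
  then show "x \<le> Suc (Max J)"
    using assms by cases (auto intro: le_SucI order_trans[OF _ Max_ge])
qed (use assms in \<open>auto simp: pushed_def\<close>)

text \<open>The cardinality is read off as the value of \<open>before\<close> beyond the maximum,
  where the gained and the lost top cancel.\<close>

lemma pushed_top_sets:
  assumes "J \<in> top_sets n" "f \<in> J" "p \<le> f"
  shows "pushed J p f \<in> top_sets n"
proof -
  have fin: "finite J" "finite (pushed J p f)" using assms by (auto simp: top_sets_def pushed_def)
  have "f < Suc (Max J)" using fin assms by (simp add: less_Suc_eq_le)
  then have "before (pushed J p f) (Suc (Suc (Max J))) = before J (Suc (Max J))"
    using assms by (subst before_pushed_high) auto
  also have "\<dots> = card J" using fin by (intro before_Max) auto
  finally have "card (pushed J p f) = card J"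
    using Max_pushed_le[OF fin(1) assms(2,3)] fin by (subst (asm) before_Max) auto
  then show ?thesis using assms fin by (auto simp: top_sets_def pushed_def)
qed

text \<open>Each step shifts all tops up by one except the last, which reappears at 0, so a prefix
  \<open>{..<m}\<close> of tops grows to \<open>{..<Suc m}\<close>. For \<open>m < n\<close> the set
  has more than \<open>m\<close> elements, hence its maximum lies outside the prefix and removing it
  does no damage.\<close>

lemma flush_reaches_prefix:
  assumes "J \<in> top_sets n"
  shows "((\<lambda>J. pushed J 0 (Max J)) ^^ n) J = {..<n}"
proof -
  let ?U = "\<lambda>J. pushed J 0 (Max J)"
  have *: "(?U ^^ m) J \<in> top_sets n \<and> {..<m} \<subseteq> (?U ^^ m) J" if "m \<le> n" for m
    using that
  proof (induction m)
    case (Suc m)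
    define I where "I = (?U ^^ m) J"
    have I: "I \<in> top_sets n" "{..<m} \<subseteq> I" using Suc by (auto simp: I_def)
    then have fin: "finite I" "I \<noteq> {}" "card I = n" by (auto simp: top_sets_def)
    have "\<not> Max I < m"
    proof
      assume "Max I < m"
      then have "I \<subseteq> {..<m}" using fin by (auto intro: le_less_trans[OF Max_ge])
      then have "card I \<le> m" using card_mono[of "{..<m}" I] by simp
      then show False using fin Suc.prems by simp
    qed
    then have "{..<Suc m} \<subseteq> ?U I"
      using I(2) by (auto simp: pushed_def lessThan_Suc_eq_insert_0)
    moreover have "?U I \<in> top_sets n"
      using I(1) fin by (intro pushed_top_sets) auto
    ultimately show ?case by (simp add: I_def)
  qed (use assms in simp)
  then have "(?U ^^ n) J \<in> top_sets n" "{..<n} \<subseteq> (?U ^^ n) J" by auto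
  then show ?thesis by (intro card_subset_eq[symmetric]) (auto simp: top_sets_def)
qed

text \<open>Raising \<open>f\<close> multiplies the old sum by \<open>c (Suc f)\<close>, while the
  new summand is the product of the \<open>a k\<close> up to \<open>f\<close> times
  \<open>a (Suc f) - c (Suc f)\<close>; the terms with \<open>c\<close> cancel. In the application
  \<open>a k\<close> and \<open>c k\<close> are the inverses of \<open>sigma_le \<sigma> j\<close>
  and \<open>sigma_le \<sigma> (Suc j)\<close> for \<open>j = before J k\<close>. The start
  \<open>d 0\<close> is separate because \<open>sigma_le \<sigma> 0 = 0\<close> has no
  inverse.\<close>

lemma telescoping_insertion_sum:
  fixes a c d :: "nat \<Rightarrow> real"
  assumes "\<And>k. k \<le> f \<Longrightarrow> c k \<noteq> 0" "\<And>k. 0 < k \<Longrightarrow> k \<le> f \<Longrightarrow> a k \<noteq> 0"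
    and "d 0 = 1 / c 0" "\<And>k. 0 < k \<Longrightarrow> k \<le> f \<Longrightarrow> d k = 1 / c k - 1 / a k"
  shows "(\<Sum>p\<le>f. d p * ((\<Prod>k=1..p. a k) * (\<Prod>k=p..f. c k))) = (\<Prod>k=1..f. a k)"
  using assms
proof (induction f)
  case (Suc f)
  have IH: "(\<Sum>p\<le>f. d p * ((\<Prod>k=1..p. a k) * (\<Prod>k=p..f. c k))) = (\<Prod>k=1..f. a k)"
    using Suc.prems by (intro Suc.IH) auto
  have "(\<Sum>p\<le>f. d p * ((\<Prod>k=1..p. a k) * (\<Prod>k=p..Suc f. c k)))
      = (\<Sum>p\<le>f. d p * ((\<Prod>k=1..p. a k) * (\<Prod>k=p..f. c k))) * c (Suc f)"
    unfolding sum_distrib_right by (intro sum.cong) (auto simp: prod.cl_ivl_Suc algebra_simps)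
  moreover have "d (Suc f) = 1 / c (Suc f) - 1 / a (Suc f)" "c (Suc f) \<noteq> 0" "a (Suc f) \<noteq> 0"
    using Suc.prems by auto
  ultimately show ?case
    unfolding sum.atMost_Suc IH by (simp add: prod.cl_ivl_Suc right_diff_distrib left_diff_distrib)
qed simp

section \<open>The weight of a state and its balance equation\<close>

locale multiqueue =
  fixes n :: nat and \<sigma> :: "nat pmf"
  assumes supp: "set_pmf \<sigma> \<subseteq> {1..n}"
    and stable: "\<And>i. i \<in> {1..<n} \<Longrightarrow> real i / real n < sigma_le \<sigma> i"
begin

lemma n_pos: "0 < n"
  using supp set_pmf_not_empty[of \<sigma>] by (cases n) auto

lemma sigma_le_0 [simp]: "sigma_le \<sigma> 0 = 0"
  by (simp add: sigma_le_def)

lemma sigma_le_Suc: "sigma_le \<sigma> (Suc j) = sigma_le \<sigma> j + pmf \<sigma> (Suc j)"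
  unfolding sigma_le_def by (simp add: measure_measure_pmf_finite atLeastAtMostSuc_conv)

lemma sigma_le_n [simp]: "sigma_le \<sigma> n = 1"
  unfolding sigma_le_def using supp by (simp add: measure_pmf.prob_eq_1 AE_measure_pmf_iff subset_eq)

lemma sigma_le_nonneg: "0 \<le> sigma_le \<sigma> j" and sigma_le_le_1: "sigma_le \<sigma> j \<le> 1"
  by (auto simp: sigma_le_def)

lemma sigma_le_pos: "0 < j \<Longrightarrow> j \<le> n \<Longrightarrow> 0 < sigma_le \<sigma> j"
proof (cases "j = n")
  case False
  assume "0 < j" "j \<le> n"
  then show ?thesis using False stable[of j] by (auto intro: le_less_trans[rotated])
qed simp

definition weight :: "nat set \<Rightarrow> real" where
  "weight J = (\<Prod>k=1..Max J. sigma_le \<sigma> (before J k))"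

lemma weight_nonneg: "0 \<le> weight J" and weight_le_1: "weight J \<le> 1"
  unfolding weight_def by (auto intro!: prod_nonneg prod_le_1 sigma_le_nonneg sigma_le_le_1)

text \<open>Beyond \<open>Max J\<close> all \<open>n\<close> labels have been seen and the factor is
  \<open>sigma_le \<sigma> n = 1\<close>. The free upper bound allows \<open>J\<close> and
  \<open>pushed J p f\<close> to be compared over one range.\<close>

lemma weight_eq:
  assumes "J \<in> top_sets n" "Max J \<le> m"
  shows "weight J = (\<Prod>k=1..m. sigma_le \<sigma> (before J k))"
proof -
  have "before J k = n" if "Max J < k" for k
    using assms that by (simp add: before_Max top_sets_def)
  then show ?thesis
    unfolding weight_def by (intro prod.mono_neutral_left) (use assms in auto)
qed

lemma weight_pos: "J \<in> top_sets n \<Longrightarrow> 0 < weight J"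
  unfolding weight_def
  by (auto intro!: prod_pos sigma_le_pos before_pos simp: top_sets_def)
     (metis before_le_card)

text \<open>The positions are cut at \<open>p\<close> and \<open>Suc f\<close>: counts are unchanged
  up to \<open>p\<close>, one larger on the middle block, and again unchanged above it. In the last
  two products \<open>k\<close> stands for the position \<open>Suc k\<close> of the pushed
  set.\<close>

lemma weight_pushed:
  assumes J: "J \<in> top_sets n" and f: "f \<in> J" "p \<le> f"
  shows "weight (pushed J p f) = (\<Prod>k=1..p. sigma_le \<sigma> (before J k))
           * (\<Prod>k=p..f. sigma_le \<sigma> (Suc (before J k))) * (\<Prod>k=Suc f..Max J. sigma_le \<sigma> (before J k))"
proof -
  have fin: "finite J" using J by (simp add: top_sets_def)
  have fM: "f \<le> Max J" using fin f by simp
  let ?s = "\<lambda>k. sigma_le \<sigma> (before (pushed J p f) k)"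
  have "weight (pushed J p f) = prod ?s {1..Suc (Max J)}"
    by (rule weight_eq[OF pushed_top_sets[OF assms] Max_pushed_le[OF fin f]])
  also have "{1..Suc (Max J)} = {1..p} \<union> Suc ` ({p..f} \<union> {Suc f..Max J})"
    using fM f by (auto simp: image_Un)
  also have "prod ?s \<dots> = prod ?s {1..p} * (prod (?s \<circ> Suc) {p..f} * prod (?s \<circ> Suc) {Suc f..Max J})"
  proof -
    have "{1..p} \<inter> Suc ` ({p..f} \<union> {Suc f..Max J}) = {}" "{p..f} \<inter> {Suc f..Max J} = {}"
      using f by auto
    then show ?thesis
      by (simp only: prod.union_disjoint finite_atLeastAtMost finite_imageI finite_Un prod.reindex inj_Suc)
  qed
  finally show ?thesis
    using f by (simp add: before_pushed_low before_pushed_high mult.assoc)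
qed

text \<open>The factors beyond \<open>f\<close> are common to all summands, and the rest telescopes
  because \<open>pmf \<sigma> (Suc j)\<close> is an increment of \<open>sigma_le \<sigma>\<close>.
  The balance holds for each \<open>f\<close> separately, before averaging over labels.\<close>

lemma stationary_weight:
  assumes J: "J \<in> top_sets n" and f: "f \<in> J"
  shows "(\<Sum>p\<le>f. pmf \<sigma> (Suc (before J p)) / weight (pushed J p f)) = 1 / weight J"
proof -
  have fin: "finite J" "card J = n" "0 \<in> J" using J by (auto simp: top_sets_def)
  have fM: "f \<le> Max J" using fin f by simp
  let ?a = "\<lambda>k. 1 / sigma_le \<sigma> (before J k)" and ?c = "\<lambda>k. 1 / sigma_le \<sigma> (Suc (before J k))"
  have lt: "before J k < n" if "k \<le> f" for k
    using before_less_card[OF fin(1) f that] fin by simp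
  have "(\<Sum>p\<le>f. pmf \<sigma> (Suc (before J p)) / weight (pushed J p f))
      = (\<Sum>p\<le>f. pmf \<sigma> (Suc (before J p)) * ((\<Prod>k=1..p. ?a k) * (\<Prod>k=p..f. ?c k))) * (\<Prod>k=Suc f..Max J. ?a k)"
    unfolding sum_distrib_right
    by (intro sum.cong refl) (simp add: weight_pushed[OF J f] prod_dividef)
  also have "(\<Sum>p\<le>f. pmf \<sigma> (Suc (before J p)) * ((\<Prod>k=1..p. ?a k) * (\<Prod>k=p..f. ?c k))) = (\<Prod>k=1..f. ?a k)"
  proof (rule telescoping_insertion_sum)
    fix k assume k: "k \<le> f"
    have "0 < sigma_le \<sigma> (Suc (before J k))" using lt[OF k] by (intro sigma_le_pos) auto
    then show "?c k \<noteq> 0" by simp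
    assume "0 < k"
    have "0 < sigma_le \<sigma> (before J k)" using lt[OF k] before_pos[OF fin(3) \<open>0 < k\<close>] by (intro sigma_le_pos) auto
    then show "?a k \<noteq> 0" by simp
  qed (simp_all add: sigma_le_Suc)
  also have "(\<Prod>k=1..f. ?a k) * (\<Prod>k=Suc f..Max J. ?a k) = (\<Prod>k=1..Max J. ?a k)"
    using fM by (subst prod.union_disjoint[symmetric]) (auto intro!: prod.cong)
  finally show ?thesis by (simp add: weight_def prod_dividef)
qed

text \<open>The Doob transform of the reversed step by its fixed density \<open>1 / weight\<close>.
  It lives on pairs, since different insertions can yield the same set: from \<open>{0, 1}\<close>,
  with \<open>f = 1\<close>, both \<open>p = 0\<close> and \<open>p = 1\<close> lead back to
  \<open>{0, 1}\<close>.\<close>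

definition kernel_weight :: "nat set \<Rightarrow> nat \<times> nat \<Rightarrow> real" where
  "kernel_weight J = (\<lambda>(f, p). if f \<in> J \<and> p \<le> f
     then pmf \<sigma> (Suc (before J p)) / real n * (weight J / weight (pushed J p f)) else 0)"

definition kernel :: "nat set \<Rightarrow> nat set pmf" where
  "kernel J = map_pmf (\<lambda>(f, p). pushed J p f) (embed_pmf (kernel_weight J))"

text \<open>The total mass is 1 by \<open>stationary_weight\<close>: each of the \<open>n\<close>
  choices of \<open>f\<close> carries mass \<open>1 / n\<close>.\<close>

lemma pmf_kernel_weight:
  assumes "J \<in> top_sets n"
  shows "pmf (embed_pmf (kernel_weight J)) = kernel_weight J"
proof
  fix x
  have nonneg: "0 \<le> kernel_weight J x" for x
    by (auto simp: kernel_weight_def weight_nonneg split: prod.split)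
  have fin: "finite J" "card J = n" using assms by (auto simp: top_sets_def)
  have "(\<integral>\<^sup>+x. ennreal (kernel_weight J x) \<partial>count_space UNIV)
      = (\<integral>\<^sup>+x. ennreal (kernel_weight J x) \<partial>count_space (SIGMA f:J. {..f}))"
    by (rule nn_integral_count_space_eq) (auto simp: kernel_weight_def split: if_splits)
  also have "\<dots> = ennreal (\<Sum>x\<in>(SIGMA f:J. {..f}). kernel_weight J x)"
    using fin nonneg by (subst nn_integral_count_space_finite) auto
  also have "(\<Sum>x\<in>(SIGMA f:J. {..f}). kernel_weight J x) = (\<Sum>f\<in>J. \<Sum>p\<le>f. kernel_weight J (f, p))"
    using fin by (subst sum.Sigma) auto
  also have "\<dots> = (\<Sum>f\<in>J. weight J / n * (\<Sum>p\<le>f. pmf \<sigma> (Suc (before J p)) / weight (pushed J p f)))"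
    unfolding sum_distrib_left by (intro sum.cong refl) (auto simp: kernel_weight_def)
  also have "\<dots> = (\<Sum>f\<in>J. 1 / n)"
    using weight_pos[OF assms] by (intro sum.cong refl) (simp add: stationary_weight[OF assms])
  also have "\<dots> = 1" using fin n_pos by simp
  finally show "pmf (embed_pmf (kernel_weight J)) x = kernel_weight J x"
    by (intro pmf_embed_pmf nonneg) simp
qed

lemma nn_integral_kernel:
  assumes "J \<in> top_sets n"
  shows "(\<integral>\<^sup>+I. \<phi> I \<partial>kernel J)
       = (\<Sum>f\<in>J. \<Sum>p\<le>f. ennreal (kernel_weight J (f, p)) * \<phi> (pushed J p f))"
proof -
  have fin: "finite J" using assms by (auto simp: top_sets_def)
  have "(\<integral>\<^sup>+I. \<phi> I \<partial>kernel J)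
      = (\<Sum>x\<in>(SIGMA f:J. {..f}). (case x of (f, p) \<Rightarrow> \<phi> (pushed J p f)) * ennreal (kernel_weight J x))"
    unfolding kernel_def nn_integral_map_pmf
  proof (subst nn_integral_measure_pmf_support[where A = "SIGMA f:J. {..f}"])
    fix x assume "x \<in> set_pmf (embed_pmf (kernel_weight J))" "x \<notin> (SIGMA f:J. {..f})"
    then show "\<phi> (case x of (f, p) \<Rightarrow> pushed J p f) = 0"
      unfolding set_pmf_iff pmf_kernel_weight[OF assms] by (cases x) (auto simp: kernel_weight_def split: if_splits)
  qed (use fin in \<open>auto simp: pmf_kernel_weight[OF assms] split_beta\<close>)
  also have "\<dots> = (\<Sum>f\<in>J. \<Sum>p\<le>f. ennreal (kernel_weight J (f, p)) * \<phi> (pushed J p f))"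
    using fin by (subst sum.Sigma) (auto simp: mult.commute intro!: sum.cong)
  finally show ?thesis .
qed

lemma flush_in_kernel:
  assumes "J \<in> top_sets n"
  shows "pushed J 0 (Max J) \<in> set_pmf (kernel J)"
proof -
  have "Max J \<in> J" using assms by (intro Max_in) (auto simp: top_sets_def)
  \<comment> \<open>Insertion at position 0 reverses a deletion with label 1, whose probability is
    \<open>sigma_le \<sigma> 1\<close> and hence positive by stability.\<close>
  moreover have "pmf \<sigma> 1 > 0"
    using sigma_le_pos[of 1] sigma_le_Suc[of 0] n_pos by simp
  ultimately have "(Max J, 0) \<in> set_pmf (embed_pmf (kernel_weight J))"
    using weight_pos[OF assms] weight_pos[OF pushed_top_sets[OF assms, of "Max J" 0]] n_pos
    unfolding set_pmf_iff pmf_kernel_weight[OF assms] by (simp add: kernel_weight_def)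
  then show ?thesis by (force simp: kernel_def)
qed

text \<open>Adjoint of one deletion step, acting on densities relative to the uniform labelling.\<close>

definition reverse_op :: "(nat set \<Rightarrow> ennreal) \<Rightarrow> nat set \<Rightarrow> ennreal" where
  "reverse_op \<phi> J = (\<Sum>f\<in>J. \<Sum>p\<le>f. ennreal (pmf \<sigma> (Suc (before J p)) / real n) * \<phi> (pushed J p f))"

text \<open>The ratio of weights in \<open>kernel_weight\<close> cancels termwise. Dividing
  densities by \<open>1 / weight\<close> thus turns the adjoint of a deletion into an honest Markov
  kernel.\<close>

lemma reverse_op_kernel:
  assumes "J \<in> top_sets n" "\<And>I. I \<in> top_sets n \<Longrightarrow> \<psi> I = \<phi> I * ennreal (1 / weight I)"
  shows "reverse_op \<psi> J = (\<integral>\<^sup>+I. \<phi> I \<partial>kernel J) * ennreal (1 / weight J)"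
  unfolding reverse_op_def nn_integral_kernel[OF assms(1)] sum_distrib_right
proof (rule sum.cong[OF refl], rule sum.cong[OF refl])
  fix f p assume f: "f \<in> J" "p \<in> {..f}"
  then have I: "pushed J p f \<in> top_sets n" using assms by (intro pushed_top_sets) auto
  define A B V W where "A = ennreal (kernel_weight J (f, p))" and "B = ennreal (pmf \<sigma> (Suc (before J p)) / n)"
    and "V = ennreal (1 / weight (pushed J p f))" and "W = ennreal (1 / weight J)"
  have "A * W = B * V"
    using f weight_pos[OF assms(1)] weight_pos[OF I]
    by (simp add: ennreal_mult[symmetric] kernel_weight_def A_def B_def V_def W_def)
  then have "B * (\<phi> (pushed J p f) * V) = A * \<phi> (pushed J p f) * W"
    by (simp add: mult.assoc mult.left_commute[of _ "\<phi> (pushed J p f)"])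
  then show "ennreal (pmf \<sigma> (Suc (before J p)) / n) * \<psi> (pushed J p f)
     = ennreal (kernel_weight J (f, p)) * \<phi> (pushed J p f) * ennreal (1 / weight J)"
    unfolding assms(2)[OF I] A_def B_def V_def W_def .
qed

end

section \<open>Independent sequences and insertion of a coordinate\<close>

abbreviation seq_space :: "(nat \<Rightarrow> 'a) measure" where
  "seq_space \<equiv> PiM UNIV (\<lambda>_. count_space UNIV)"

abbreviation iid :: "'a pmf \<Rightarrow> (nat \<Rightarrow> 'a) measure" where
  "iid P \<equiv> PiM UNIV (\<lambda>_. measure_pmf P)"

lemma sets_iid [measurable_cong]: "sets (iid P) = sets seq_space"
  by (rule sets_PiM_cong) auto

lemma space_iid [simp]: "space (iid P) = UNIV"
  by (simp add: space_PiM)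

lemma prob_space_iid: "prob_space (iid P)"
  by (intro prob_space_PiM measure_pmf.prob_space_axioms)

lemma emeasure_iid_cylinder:
  assumes "finite I"
  shows "emeasure (iid P) {\<omega>. \<forall>i\<in>I. \<omega> i \<in> A i} = (\<Prod>i\<in>I. emeasure (measure_pmf P) (A i))"
proof -
  have "{\<omega>. \<forall>i\<in>I. \<omega> i \<in> A i} = prod_emb UNIV (\<lambda>_. measure_pmf P) I (Pi\<^sub>E I A)"
    by (auto simp: prod_emb_def space_PiM)
  then show ?thesis
    using assms by (simp add: emeasure_PiM_emb measure_pmf.prob_space_axioms)
qed

text \<open>Two prefix cylinders are nested or disjoint, so with the empty set they form an
  intersection-stable system. It generates the product algebra because a coordinate event is a union
  over the countably many prefixes of sufficient length.\<close>

lemma measure_eqI_prefix: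
  fixes M N :: "(nat \<Rightarrow> 'a :: countable) measure"
  assumes M: "sets M = sets seq_space" and N: "sets N = sets seq_space"
    and eq: "\<And>m x. emeasure M {\<omega>. \<forall>i<m. \<omega> i = x i} = emeasure N {\<omega>. \<forall>i<m. \<omega> i = x i}"
    and fin: "emeasure M UNIV \<noteq> \<infinity>"
  shows "M = N"
proof -
  define C where "C = (\<lambda>m (x :: nat \<Rightarrow> 'a). {\<omega>. \<forall>i<m. \<omega> i = x i})"
  define E where "E = insert {} (\<Union>m. range (C m))"
  have C_in: "C m x \<in> E" for m x by (auto simp: E_def)
  have gen: "sets (seq_space :: (nat \<Rightarrow> 'a) measure) = sigma_sets UNIV E"
  proof -
    have "sets (seq_space :: (nat \<Rightarrow> 'a) measure)
        = sigma_sets UNIV {{f. f i \<in> A} | i A. True}"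
      by (subst sets_PiM_single) simp
    also have "\<dots> = sigma_sets UNIV E"
    proof (rule sigma_sets_eqI)
      fix X :: "(nat \<Rightarrow> 'a) set" assume "X \<in> {{f. f i \<in> A} | i A. True}"
      then obtain i A where X: "X = {f. f i \<in> A}" by auto
      have "X = (\<Union>xs\<in>{xs :: 'a list. length xs = Suc i \<and> xs ! i \<in> A}. C (Suc i) (nth xs))"
      proof safe
        fix f assume "f \<in> X"
        then show "f \<in> (\<Union>xs\<in>{xs :: 'a list. length xs = Suc i \<and> xs ! i \<in> A}. C (Suc i) (nth xs))"
          by (intro UN_I[of "map f [0..<Suc i]"]) (auto simp: X C_def simp del: upt_Suc)
      qed (auto simp: X C_def)
      also have "\<dots> \<in> sigma_sets UNIV E"
        by (intro sigma_sets_UNION) (auto intro: C_in)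
      finally show "X \<in> sigma_sets UNIV E" .
    next
      fix X assume "X \<in> E"
      moreover have "C m x \<in> sets seq_space" for m x
      proof -
        have "{\<omega> \<in> space seq_space. \<forall>i<m. \<omega> i = x i} \<in> sets seq_space" by measurable
        then show ?thesis by (simp add: C_def space_PiM)
      qed
      ultimately have "X \<in> sets seq_space" by (auto simp: E_def)
      then show "X \<in> sigma_sets UNIV {{f. f i \<in> A} | i A. True}"
        by (subst (asm) sets_PiM_single) simp
    qed
    finally show ?thesis .
  qed
  show ?thesis
  proof (rule measure_eqI_generator_eq[where E = E and \<Omega> = UNIV and A = "\<lambda>_. UNIV"])
    show "Int_stable E"
    proof (rule Int_stableI)
      have "C m x \<inter> C k y \<in> E" if "m \<le> k" for m k x y
      proof (cases "\<forall>i<m. x i = y i")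
        case True
        then have "C m x \<inter> C k y = C k y" using that by (auto simp: C_def)
        then show ?thesis using C_in by simp
      next
        case False
        then have "C m x \<inter> C k y = {}" using that by (force simp: C_def)
        then show ?thesis by (simp add: E_def)
      qed
      then have C_int: "C m x \<inter> C k y \<in> E" for m k x y
        by (metis Int_commute linear)
      show "X \<inter> Y \<in> E" if XY: "X \<in> E" "Y \<in> E" for X Y
      proof -
        consider "X = {}" | "Y = {}" | m x k y where "X = C m x" "Y = C k y"
          using XY by (auto simp: E_def)
        then show ?thesis using C_int by cases (auto simp: E_def)
      qed
    qed
    show "emeasure M X = emeasure N X" if "X \<in> E" for X
      using that eq by (auto simp: E_def C_def)
    show "range (\<lambda>_. UNIV) \<subseteq> E"
      using C_in[of 0] by (auto simp: C_def)
  qed (use M N fin gen in auto)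
qed

section \<open>Inserting and removing one coordinate\<close>

definition insert_at :: "nat \<Rightarrow> 'a \<Rightarrow> (nat \<Rightarrow> 'a) \<Rightarrow> nat \<Rightarrow> 'a" where
  "insert_at p q b k = (if k < p then b k else if k = p then q else b (k - 1))"

definition remove_at :: "nat \<Rightarrow> (nat \<Rightarrow> 'a) \<Rightarrow> nat \<Rightarrow> 'a" where
  "remove_at p b k = (if k < p then b k else b (Suc k))"

lemma remove_at_insert_at [simp]: "remove_at p (insert_at p q b) = b"
  by (auto simp: fun_eq_iff remove_at_def insert_at_def)

lemma measurable_insert_at [measurable]:
  "(\<lambda>(q, b). insert_at p q b) \<in> count_space UNIV \<Otimes>\<^sub>M seq_space \<rightarrow>\<^sub>M seq_space"
  unfolding split_beta
  by (rule measurable_PiM_single') (auto simp: insert_at_def)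

lemma measurable_remove_at [measurable]: "remove_at p \<in> seq_space \<rightarrow>\<^sub>M seq_space"
  by (rule measurable_PiM_single') (auto simp: remove_at_def)

lemma distr_insert_at:
  fixes P :: "'a :: countable pmf"
  shows "distr (measure_pmf P \<Otimes>\<^sub>M iid P) (iid P) (\<lambda>(q, b). insert_at p q b) = iid P" (is "?D = _")
proof (rule measure_eqI_prefix)
  interpret P: prob_space "iid P" by (rule prob_space_iid)
  interpret PP: pair_prob_space "measure_pmf P" "iid P" ..
  have meas: "(\<lambda>(q, b). insert_at p q b) \<in> measure_pmf P \<Otimes>\<^sub>M iid P \<rightarrow>\<^sub>M iid P"
    by measurable
  interpret D: prob_space ?D
    by (rule PP.prob_space_distr[OF meas])
  show "emeasure ?D UNIV \<noteq> \<infinity>" by simp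
  fix m and x :: "nat \<Rightarrow> 'a"
  \<comment> \<open>\<open>g i\<close> is the place of the old coordinate \<open>i\<close> after the
    insertion. The first \<open>m\<close> new entries constrain the old coordinates in
    \<open>I\<close>, and the inserted label only if \<open>p < m\<close>, which is what
    \<open>A\<close> records.\<close>
  define g where "g i = (if i < p then i else Suc i)" for i
  define I where "I = {i. g i < m}"
  define A where "A = (if p < m then {x p} else UNIV)"
  have fin: "finite I" by (rule finite_subset[of _ "{..<m}"]) (auto simp: I_def g_def)
  have inj: "inj g" by (auto simp: inj_def g_def split: if_splits)
  have "emeasure ?D {\<omega>. \<forall>i<m. \<omega> i = x i}
      = emeasure (measure_pmf P \<Otimes>\<^sub>M iid P) ((\<lambda>(q, b). insert_at p q b) -` {\<omega>. \<forall>i<m. \<omega> i = x i} \<inter> space (measure_pmf P \<Otimes>\<^sub>M iid P))"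
  proof (rule emeasure_distr[OF meas])
    have "{\<omega> \<in> space (iid P). \<forall>i<m. \<omega> i = x i} \<in> sets (iid P)" by measurable
    then show "{\<omega>. \<forall>i<m. \<omega> i = x i} \<in> sets (iid P)" by simp
  qed
  also have "(\<lambda>(q, b). insert_at p q b) -` {\<omega>. \<forall>i<m. \<omega> i = x i} \<inter> space (measure_pmf P \<Otimes>\<^sub>M iid P)
     = A \<times> {b. \<forall>i\<in>I. b i \<in> {x (g i)}}"
  proof -
    have "(\<forall>i<m. insert_at p q b i = x i) \<longleftrightarrow> q \<in> A \<and> (\<forall>i\<in>I. b i = x (g i))" for q b
    proof safe
      assume *: "\<forall>i<m. insert_at p q b i = x i"
      show "q \<in> A" using *[rule_format, of p] by (auto simp: A_def insert_at_def)
      show "b i = x (g i)" if "i \<in> I" for i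
        using *[rule_format, of "g i"] that by (auto simp: I_def insert_at_def g_def split: if_splits)
    next
      fix i assume *: "q \<in> A" "\<forall>i\<in>I. b i = x (g i)" "i < m"
      consider "i < p" | "i = p" | j where "i = Suc j" "p \<le> j" by (cases i) force+
      then show "insert_at p q b i = x i"
      proof cases
        case 1 then show ?thesis using * by (force simp: insert_at_def I_def g_def)
      next
        case 2 then show ?thesis using * by (auto simp: insert_at_def A_def)
      next
        case 3 then show ?thesis using *(2)[rule_format, of j] *(3) by (auto simp: insert_at_def I_def g_def)
      qed
    qed
    then show ?thesis by (auto simp: space_pair_measure)
  qed
  also have "emeasure (measure_pmf P \<Otimes>\<^sub>M iid P) \<dots> = emeasure P A * emeasure (iid P) {b. \<forall>i\<in>I. b i \<in> {x (g i)}}"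
  proof (rule P.emeasure_pair_measure_Times)
    have "{\<omega> \<in> space (iid P). \<forall>i\<in>I. \<omega> i \<in> {x (g i)}} \<in> sets (iid P)" using fin by measurable
    then show "{b. \<forall>i\<in>I. b i \<in> {x (g i)}} \<in> sets (iid P)" by simp
  qed simp
  also have "emeasure (iid P) {b. \<forall>i\<in>I. b i \<in> {x (g i)}} = (\<Prod>i\<in>I. emeasure P {x (g i)})"
    by (rule emeasure_iid_cylinder[OF fin])
  also have "\<dots> = (\<Prod>i\<in>g ` I. emeasure P {x i})"
    using inj by (subst prod.reindex) (auto intro: inj_on_subset)
  also have "emeasure P A * \<dots> = (\<Prod>i\<in>{..<m}. emeasure P {x i})"
  proof -
    have *: "{..<m} = (if p < m then insert p (g ` I) else g ` I)" "p \<notin> g ` I"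
    proof -
      have "i \<in> g ` I" if "i < m" "i \<noteq> p" for i
      proof (cases "i < p")
        case True
        then show ?thesis using that by (intro image_eqI[of _ _ i]) (auto simp: g_def I_def)
      next
        case False
        then show ?thesis using that by (intro image_eqI[of _ _ "i - 1"]) (auto simp: g_def I_def)
      qed
      then show "{..<m} = (if p < m then insert p (g ` I) else g ` I)" 
        by (auto simp: I_def)
      show "p \<notin> g ` I" by (auto simp: g_def)
    qed
    show ?thesis
      using fin *(2) measure_pmf.emeasure_space_1[of P] unfolding *(1) by (auto simp: A_def)
  qed
  also have "\<dots> = emeasure (iid P) {\<omega>. \<forall>i\<in>{..<m}. \<omega> i \<in> {x i}}"
    by (subst emeasure_iid_cylinder) auto
  finally show "emeasure ?D {\<omega>. \<forall>i<m. \<omega> i = x i} = emeasure (iid P) {\<omega>. \<forall>i<m. \<omega> i = x i}"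
    by (simp add: Ball_def)
qed (simp_all add: sets_iid)

text \<open>Isolates coordinate \<open>p\<close> as an independent variable. It serves three
  purposes: undoing a deletion at \<open>p\<close>, conditioning on the first sampled label with
  \<open>p = 0\<close>, and extending a prefix of length \<open>p\<close>.\<close>

lemma nn_integral_iid_insert_at:
  fixes P :: "'a :: countable pmf"
  assumes [measurable]: "F \<in> borel_measurable seq_space"
  shows "(\<integral>\<^sup>+b. F b \<partial>iid P) = (\<integral>\<^sup>+b. \<integral>\<^sup>+q. F (insert_at p q b) \<partial>P \<partial>iid P)"
proof -
  interpret P: prob_space "iid P" by (rule prob_space_iid)
  interpret PP: pair_prob_space "measure_pmf P" "iid P" ..
  have "(\<integral>\<^sup>+b. F b \<partial>iid P) = (\<integral>\<^sup>+b. F b \<partial>distr (measure_pmf P \<Otimes>\<^sub>M iid P) (iid P) (\<lambda>(q, b). insert_at p q b))"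
    by (simp only: distr_insert_at)
  also have "\<dots> = (\<integral>\<^sup>+(q, b). F (insert_at p q b) \<partial>(measure_pmf P \<Otimes>\<^sub>M iid P))"
    by (subst nn_integral_distr) (auto simp: split_beta')
  also have "\<dots> = (\<integral>\<^sup>+b. \<integral>\<^sup>+q. F (insert_at p q b) \<partial>P \<partial>iid P)"
    by (subst PP.nn_integral_snd[symmetric]) auto
  finally show ?thesis .
qed

text \<open>\<open>mq_space\<close> pairs assignment and sampled label in each coordinate.
  Separating the two sequences allows the labels to be integrated out for a fixed
  assignment.\<close>

lemma distr_iid_pair:
  fixes A :: "'a :: countable pmf" and B :: "'b :: countable pmf"
  shows "distr (iid A \<Otimes>\<^sub>M iid B) (iid (pair_pmf A B)) (\<lambda>(a, c) k. (a k, c k)) = iid (pair_pmf A B)" (is "?D = _")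
proof (rule measure_eqI_prefix)
  interpret A: prob_space "iid A" by (rule prob_space_iid)
  interpret B: prob_space "iid B" by (rule prob_space_iid)
  interpret PP: pair_prob_space "iid A" "iid B" ..
  have meas: "(\<lambda>(a, c) k. (a k, c k)) \<in> iid A \<Otimes>\<^sub>M iid B \<rightarrow>\<^sub>M iid (pair_pmf A B)"
    unfolding split_beta by (rule measurable_PiM_single') auto
  interpret D: prob_space ?D
    by (rule PP.prob_space_distr[OF meas])
  show "emeasure ?D UNIV \<noteq> \<infinity>" by simp
  fix m and x :: "nat \<Rightarrow> 'a \<times> 'b"
  have "emeasure ?D {\<omega>. \<forall>i<m. \<omega> i = x i}
      = emeasure (iid A \<Otimes>\<^sub>M iid B) ((\<lambda>(a, c) k. (a k, c k)) -` {\<omega>. \<forall>i<m. \<omega> i = x i} \<inter> space (iid A \<Otimes>\<^sub>M iid B))"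
  proof (rule emeasure_distr[OF meas])
    have "{\<omega> \<in> space (iid (pair_pmf A B)). \<forall>i<m. \<omega> i = x i} \<in> sets (iid (pair_pmf A B))" by measurable
    then show "{\<omega>. \<forall>i<m. \<omega> i = x i} \<in> sets (iid (pair_pmf A B))" by simp
  qed
  also have "(\<lambda>(a, c) k. (a k, c k)) -` {\<omega>. \<forall>i<m. \<omega> i = x i} \<inter> space (iid A \<Otimes>\<^sub>M iid B)
     = {a. \<forall>i\<in>{..<m}. a i \<in> {fst (x i)}} \<times> {c. \<forall>i\<in>{..<m}. c i \<in> {snd (x i)}}"
    by (auto simp: space_pair_measure prod_eq_iff)
  also have "emeasure (iid A \<Otimes>\<^sub>M iid B) \<dots> = emeasure (iid A) {a. \<forall>i\<in>{..<m}. a i \<in> {fst (x i)}}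
     * emeasure (iid B) {c. \<forall>i\<in>{..<m}. c i \<in> {snd (x i)}}"
  proof (rule B.emeasure_pair_measure_Times)
    have "{\<omega> \<in> space (iid A). \<forall>i\<in>{..<m}. \<omega> i \<in> {fst (x i)}} \<in> sets (iid A)" by measurable
    then show "{a. \<forall>i\<in>{..<m}. a i \<in> {fst (x i)}} \<in> sets (iid A)" by simp
    have "{\<omega> \<in> space (iid B). \<forall>i\<in>{..<m}. \<omega> i \<in> {snd (x i)}} \<in> sets (iid B)" by measurable
    then show "{c. \<forall>i\<in>{..<m}. c i \<in> {snd (x i)}} \<in> sets (iid B)" by simp
  qed
  also have "\<dots> = (\<Prod>i\<in>{..<m}. emeasure (pair_pmf A B) {x i})"
  proof -
    have "emeasure A {fst y} * emeasure B {snd y} = emeasure (pair_pmf A B) {y}" for y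
      by (cases y) (simp add: emeasure_pmf_single pmf_pair ennreal_mult)
    then show ?thesis
      unfolding emeasure_iid_cylinder[OF finite_lessThan] prod.distrib[symmetric] by simp
  qed
  also have "\<dots> = emeasure (iid (pair_pmf A B)) {\<omega>. \<forall>i\<in>{..<m}. \<omega> i \<in> {x i}}"
    by (subst emeasure_iid_cylinder) auto
  finally show "emeasure ?D {\<omega>. \<forall>i<m. \<omega> i = x i} = emeasure (iid (pair_pmf A B)) {\<omega>. \<forall>i<m. \<omega> i = x i}"
    by (simp add: Ball_def)
qed (simp_all add: sets_iid)

text \<open>Missing \<open>q\<close> on \<open>t\<close> consecutive positions has probability
  \<open>r ^ t\<close> with \<open>r < 1\<close>. Hence missing \<open>q\<close> from
  \<open>m\<close> onwards is a null event, for each of the countably many \<open>m\<close>.\<close>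

lemma AE_iid_infinitely_often:
  fixes P :: "'a :: countable pmf"
  assumes "q \<in> set_pmf P"
  shows "AE b in iid P. infinite {k. b k = q}"
proof -
  interpret P: prob_space "iid P" by (rule prob_space_iid)
  define r where "r = measure_pmf.prob P (- {q})"
  have r: "r < 1" "0 \<le> r"
    using pmf_positive[OF assms] measure_pmf.prob_compl[of "{q}" P]
    by (auto simp: r_def Compl_eq_Diff_UNIV measure_pmf_single pmf_le_1)
  have "AE b in iid P. \<exists>k\<ge>m. b k = q" for m
  proof -
    have set_in: "{b. \<forall>k\<in>I. b k \<in> - {q}} \<in> sets (iid P)" for I
    proof -
      have "{b \<in> space (iid P). \<forall>k\<in>I. b k \<in> - {q}} \<in> sets (iid P)" by measurable
      then show ?thesis by simp
    qed
    have "P.prob {b. \<forall>k\<in>{m..}. b k \<in> - {q}} \<le> r ^ t" for t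
    proof -
      have "P.prob {b. \<forall>k\<in>{m..}. b k \<in> - {q}} \<le> P.prob {b. \<forall>k\<in>{m..<m+t}. b k \<in> - {q}}"
        by (rule P.finite_measure_mono[OF _ set_in]) auto
      also have "\<dots> = r ^ t"
      proof -
        have "emeasure (iid P) {b. \<forall>k\<in>{m..<m+t}. b k \<in> - {q}} = ennreal (r ^ t)"
          unfolding emeasure_iid_cylinder[OF finite_atLeastLessThan]
          by (simp add: measure_pmf.emeasure_eq_measure r_def ennreal_power)
        then show ?thesis using r by (simp add: measure_def)
      qed
      finally show ?thesis .
    qed
    moreover have "(\<lambda>t. r ^ t) \<longlonglongrightarrow> 0" using r by (intro LIMSEQ_realpow_zero) auto
    ultimately have "P.prob {b. \<forall>k\<in>{m..}. b k \<in> - {q}} \<le> 0"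
      by (intro LIMSEQ_le_const) auto
    then have "emeasure (iid P) {b. \<forall>k\<in>{m..}. b k \<in> - {q}} = 0"
      by (simp add: P.emeasure_eq_measure measure_le_0_iff)
    then show ?thesis
      by (intro AE_I[OF _ _ set_in]) auto
  qed
  then have "AE b in iid P. \<forall>m. \<exists>k\<ge>m. b k = q" by (simp add: AE_all_countable)
  then show ?thesis by eventually_elim (simp add: infinite_nat_iff_unbounded_le)
qed

section \<open>Deletions as removals from a label sequence\<close>

text \<open>The almost sure event on which every \<open>LEAST\<close> defining a top is attained. On
  it the combinatorics is deterministic.\<close>

definition recurrent :: "nat \<Rightarrow> (nat \<Rightarrow> nat) \<Rightarrow> bool" where
  "recurrent n b \<longleftrightarrow> range b \<subseteq> {1..n} \<and> (\<forall>q\<in>{1..n}. infinite {k. b k = q})"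

text \<open>\<open>mq_top\<close> is used with no deleted elements: deletions are encoded by
  shortening the sequence \<open>b\<close> itself, so the tops are the first appearances of the
  labels.\<close>

definition first_positions :: "nat \<Rightarrow> (nat \<Rightarrow> nat) \<Rightarrow> nat set" where
  "first_positions n b = mq_top b {} ` {1..n}"

lemma recurrent_range: "recurrent n b \<Longrightarrow> b k \<in> {1..n}"
  by (auto simp: recurrent_def subset_eq)

lemma mq_top_eq_iff:
  assumes "recurrent n b" "q \<in> {1..n}"
  shows "mq_top b {} q = k \<longleftrightarrow> b k = q \<and> q \<notin> b ` {..<k}"
proof -
  have "\<exists>k. b k = q"
    using assms infinite_imp_nonempty[of "{k. b k = q}"] by (auto simp: recurrent_def)
  then have *: "b (LEAST k. b k = q) = q" by (rule LeastI_ex)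
  show ?thesis
    using * by (auto simp: mq_top_def dest: not_less_Least intro!: Least_equality)
       (metis image_eqI lessThan_iff not_le_imp_less)
qed

lemma first_positions_iff:
  assumes "recurrent n b"
  shows "k \<in> first_positions n b \<longleftrightarrow> b k \<notin> b ` {..<k}"
proof -
  have "b k \<in> {1..n}" by (rule recurrent_range[OF assms])
  then show ?thesis
    using mq_top_eq_iff[OF assms] unfolding first_positions_def image_iff by metis
qed

lemma inj_on_mq_top: "recurrent n b \<Longrightarrow> inj_on (mq_top b {}) {1..n}"
  by (rule inj_on_inverseI[where g = b]) (use mq_top_eq_iff in blast)

lemma before_first_positions:
  assumes "recurrent n b"
  shows "before (first_positions n b) k = card (b ` {..<k})"
proof -
  let ?A = "first_positions n b \<inter> {..<k}"
  have "inj_on b ?A"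
  proof (rule linorder_inj_onI)
    fix x y assume "x < y" "x \<in> ?A" "y \<in> ?A"
    then have "b y \<notin> b ` {..<y}" "b x \<in> b ` {..<y}"
      using first_positions_iff[OF assms] by auto
    then show "b x \<noteq> b y" by metis
  qed auto
  moreover have "b ` ?A = b ` {..<k}"
  proof safe
    fix i assume "i < k"
    let ?j = "mq_top b {} (b i)"
    have i: "b i \<in> {1..n}" by (rule recurrent_range[OF assms])
    have j: "b ?j = b i" "b i \<notin> b ` {..<?j}" using mq_top_eq_iff[OF assms i] by blast+
    then have "?j \<le> i" by (metis image_eqI lessThan_iff not_le_imp_less)
    moreover have "?j \<in> first_positions n b" using i by (auto simp: first_positions_def)
    ultimately show "b i \<in> b ` ?A" using j \<open>i < k\<close> by (intro image_eqI[of _ _ ?j]) auto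
  qed auto
  ultimately show ?thesis unfolding before_def using card_image by fastforce
qed

lemma first_positions_top_sets: "recurrent n b \<Longrightarrow> first_positions n b \<in> top_sets n"
  using first_positions_iff[of n b 0] card_image[OF inj_on_mq_top, of n b]
  by (auto simp: top_sets_def) (auto simp: first_positions_def)

lemma recurrent_insert_at:
  assumes "recurrent n b" "q \<in> {1..n}"
  shows "recurrent n (insert_at p q b)"
  unfolding recurrent_def
proof safe
  fix r assume "r \<in> {1..n}" and fin: "finite {k. insert_at p q b k = r}"
  then have inf: "infinite {k. b k = r}" using assms by (auto simp: recurrent_def)
  have "(\<lambda>k. if k < p then k else Suc k) ` {k. b k = r} \<subseteq> {k. insert_at p q b k = r}"
    by (auto simp: insert_at_def)
  then have "finite ((\<lambda>k. if k < p then k else Suc k) ` {k. b k = r})"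
    using fin by (rule finite_subset)
  then have "finite {k. b k = r}"
    by (rule finite_imageD) (auto simp: inj_on_def split: if_splits)
  with inf show False by simp
qed (use assms(2) recurrent_range[OF assms(1)] in \<open>auto simp: insert_at_def\<close>)

lemma recurrent_remove_at:
  assumes "recurrent n b"
  shows "recurrent n (remove_at p b)"
  unfolding recurrent_def
proof safe
  fix r assume "r \<in> {1..n}" and fin: "finite {k. remove_at p b k = r}"
  have "{k. b k = r} \<subseteq> insert p ((\<lambda>k. if k < p then k else Suc k) ` {k. remove_at p b k = r})"
  proof
    fix k assume "k \<in> {k. b k = r}"
    then show "k \<in> insert p ((\<lambda>k. if k < p then k else Suc k) ` {k. remove_at p b k = r})"
      by (cases k p rule: linorder_cases)
         (auto simp: remove_at_def intro: image_eqI[of _ _ k] image_eqI[of _ _ "k - 1"])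
  qed
  then have "finite {k. b k = r}" using fin by (meson finite_imageI finite_insert finite_subset)
  then show False using assms \<open>r \<in> {1..n}\<close> by (auto simp: recurrent_def)
qed (use recurrent_range[OF assms] in \<open>auto simp: remove_at_def\<close>)

lemma not_seen_iff:
  assumes "recurrent n b" "q \<in> {1..n}"
  shows "q \<notin> b ` {..<p} \<longleftrightarrow> p \<le> mq_top b {} q"
proof -
  have "b (mq_top b {} q) = q" "q \<notin> b ` {..<mq_top b {} q}"
    using mq_top_eq_iff[OF assms] by blast+
  then show ?thesis by (force simp: image_iff not_less[symmetric])
qed

text \<open>As \<open>q\<close> is unseen before \<open>p\<close>, the inserted copy becomes its
  first appearance and the former one loses that status. All other labels keep theirs, shifted if it
  lies at or beyond \<open>p\<close>.\<close>

lemma first_positions_insert_at: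
  assumes b: "recurrent n b" and q: "q \<in> {1..n}" "q \<notin> b ` {..<p}"
  shows "first_positions n (insert_at p q b) = pushed (first_positions n b) p (mq_top b {} q)"
proof (rule set_eqI)
  fix k
  let ?b = "insert_at p q b" and ?J = "first_positions n b" and ?f = "mq_top b {} q"
  have b': "recurrent n ?b" by (rule recurrent_insert_at[OF b q(1)])
  have f: "b ?f = q" "?f \<in> ?J" using mq_top_eq_iff[OF b q(1)] q by (auto simp: first_positions_def)
  consider "k < p" | "k = p" | j where "k = Suc j" "p \<le> j" by (cases k) force+
  then show "k \<in> first_positions n ?b \<longleftrightarrow> k \<in> pushed ?J p ?f"
  proof cases
    case 1
    then have "?b ` {..<k} = b ` {..<k}" "?b k = b k" by (auto simp: insert_at_def intro!: image_cong)
    then show ?thesis using 1 by (auto simp: first_positions_iff[OF b'] first_positions_iff[OF b] pushed_def)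
  next
    case 2
    then have "?b ` {..<k} = b ` {..<k}" "?b k = q" by (auto simp: insert_at_def intro!: image_cong)
    then show ?thesis using 2 q by (auto simp: first_positions_iff[OF b'] pushed_def)
  next
    case 3
    \<comment> \<open>Before the shifted position \<open>Suc j\<close> one sees what
      \<open>b\<close> shows before \<open>j\<close>, and additionally \<open>q\<close>.\<close>
    have "{..<k} = {..<p} \<union> {p} \<union> Suc ` {p..<j}"
    proof safe
      fix x assume "x < k" "x \<notin> Suc ` {p..<j}" "\<not> x < p"
      then show "x = p" using 3 by (cases x) auto
    qed (use 3 in auto)
    then have "?b ` {..<k} = ?b ` {..<p} \<union> {?b p} \<union> (\<lambda>i. ?b (Suc i)) ` {p..<j}"
      by (simp only: image_Un image_image image_insert image_empty)
    also have "\<dots> = b ` {..<p} \<union> {q} \<union> b ` {p..<j}"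
      by (auto simp: insert_at_def image_iff)
    also have "\<dots> = insert q (b ` {..<j})"
    proof -
      have "{..<j} = {..<p} \<union> {p..<j}" using 3 by auto
      then show ?thesis by (auto simp: image_Un)
    qed
    finally have "k \<in> first_positions n ?b \<longleftrightarrow> b j \<noteq> q \<and> j \<in> ?J"
      using 3 by (simp add: first_positions_iff[OF b'] first_positions_iff[OF b]) (auto simp: insert_at_def)
    moreover have "b j \<noteq> q \<longleftrightarrow> j \<noteq> ?f" if "j \<in> ?J"
      using that f mq_top_eq_iff[OF b q(1), of j] first_positions_iff[OF b, of j] by auto
    ultimately show ?thesis using 3 by (auto simp: pushed_def)
  qed
qed

section \<open>Deletion as an operation on label sequences\<close>

lemma before_sorted_nth:
  assumes "finite J" "i < card J"
  shows "before J (sorted_list_of_set J ! i) = i"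
proof -
  let ?l = "sorted_list_of_set J"
  have l: "set ?l = J" "length ?l = card J" "sorted_wrt (<) ?l" "distinct ?l"
    using assms by auto
  have "J \<inter> {..<?l ! i} = (!) ?l ` {..<i}"
  proof safe
    fix x assume "x \<in> J" "x < ?l ! i"
    then obtain j where j: "j < length ?l" "x = ?l ! j" using l by (metis in_set_conv_nth)
    have "j < i"
    proof (rule ccontr)
      assume "\<not> j < i"
      then have "?l ! i \<le> ?l ! j"
        using sorted_wrt_nth_less[OF l(3), of i j] j by (cases "i = j") auto
      then show False using \<open>x < ?l ! i\<close> j by simp
    qed
    then show "x \<in> (!) ?l ` {..<i}" using j by auto
  next
    fix j assume "j < i"
    then show "?l ! j \<in> J" "?l ! j < ?l ! i"
      using l assms sorted_wrt_nth_less[OF l(3), of j i] nth_mem[of j ?l] by auto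
  qed
  moreover have "inj_on ((!) ?l) {..<i}"
    using l assms by (auto intro!: inj_on_nth)
  ultimately show ?thesis by (simp add: before_def card_image)
qed

text \<open>The gap left by the deleted entry is closed, so that positions in the sequence remain
  ranks minus one. Labels count from 1 and list entries from 0.\<close>

definition delete_label :: "nat \<Rightarrow> nat \<Rightarrow> (nat \<Rightarrow> nat) \<Rightarrow> nat \<Rightarrow> nat" where
  "delete_label n i b = remove_at (sorted_list_of_set (first_positions n b) ! (i - 1)) b"

primrec remaining :: "nat \<Rightarrow> (nat \<Rightarrow> nat) \<Rightarrow> (nat \<Rightarrow> nat) \<Rightarrow> nat \<Rightarrow> nat \<Rightarrow> nat" where
  "remaining n a c 0 = a"
| "remaining n a c (Suc s) = delete_label n (c s) (remaining n a c s)"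

lemma recurrent_delete_label: "recurrent n b \<Longrightarrow> recurrent n (delete_label n i b)"
  unfolding delete_label_def by (rule recurrent_remove_at)

lemma recurrent_remaining: "recurrent n a \<Longrightarrow> recurrent n (remaining n a c s)"
  by (induction s) (auto intro: recurrent_delete_label)

text \<open>\<open>remaining\<close> recurses on the last deletion. Splitting off the first one
  instead is what conditioning on the first sampled label requires.\<close>

lemma remaining_Suc_shift:
  "remaining n a c (Suc s) = remaining n (delete_label n (c 0) a) (c \<circ> Suc) s"
  by (induction s) auto

text \<open>Reindexes from sampled labels to deleted positions: the top at \<open>p\<close> has
  label \<open>Suc (before J p)\<close>. This form no longer mentions sorting.\<close>

lemma sum_delete_label:
  assumes "recurrent n b"
  shows "(\<Sum>i=1..n. w i * F (delete_label n i b))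
       = (\<Sum>p\<in>first_positions n b. w (Suc (before (first_positions n b) p)) * F (remove_at p b))"
proof -
  let ?J = "first_positions n b"
  let ?l = "sorted_list_of_set ?J"
  have J: "finite ?J" "card ?J = n" using first_positions_top_sets[OF assms] by (auto simp: top_sets_def)
  have "bij_betw ((!) ?l) {..<n} ?J"
    using J by (intro bij_betw_nth) auto
  then have "(\<Sum>p\<in>?J. w (Suc (before ?J p)) * F (remove_at p b))
     = (\<Sum>i<n. w (Suc (before ?J (?l ! i))) * F (remove_at (?l ! i) b))"
    by (rule sum.reindex_bij_betw[symmetric])
  also have "\<dots> = (\<Sum>i<n. w (Suc i) * F (delete_label n (Suc i) b))"
    using J by (intro sum.cong) (auto simp: before_sorted_nth delete_label_def)
  also have "\<dots> = (\<Sum>i=1..n. w i * F (delete_label n i b))"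
    by (rule sum.reindex_bij_witness[of _ "\<lambda>i. i - 1" Suc]) auto
  finally show ?thesis by simp
qed

text \<open>The invariant linking the two models: \<open>e\<close> lists the remaining elements in
  increasing order and \<open>a \<circ> e\<close> reads off their queues. Deleting the element
  \<open>e p\<close> amounts to removing position \<open>p\<close> from \<open>e\<close>.\<close>

lemma remaining_enumerates:
  assumes a: "recurrent n a" and c: "\<And>s. c s \<in> {1..n}"
  shows "\<exists>e. strict_mono e \<and> range e = - mq_deleted n a c s \<and> a \<circ> e = remaining n a c s
     \<and> mq_tops n a (mq_deleted n a c s) = map e (sorted_list_of_set (first_positions n (remaining n a c s)))"
proof -
  \<comment> \<open>An increasing enumeration carries first appearances to top-elements and respects
    their order.\<close>
  have tops: "mq_tops n a D = map e (sorted_list_of_set (first_positions n (a \<circ> e)))"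
    if e: "strict_mono e" "range e = - D" and rec: "recurrent n (a \<circ> e)" for e :: "nat \<Rightarrow> nat" and D
  proof -
    have "mq_top a D q = e (mq_top (a \<circ> e) {} q)" if q: "q \<in> {1..n}" for q
    proof -
      let ?m = "mq_top (a \<circ> e) {} q"
      have m: "a (e ?m) = q" "q \<notin> (a \<circ> e) ` {..<?m}"
        using mq_top_eq_iff[OF rec q, of ?m] by auto
      show ?thesis unfolding mq_top_def[of a D]
      proof (rule Least_equality)
        show "e ?m \<notin> D \<and> a (e ?m) = q" using m e(2) by auto
        fix y assume y: "y \<notin> D \<and> a y = q"
        then obtain j where j: "y = e j" using e(2) by blast
        then have "\<not> j < ?m" using m(2) y by auto
        then show "e ?m \<le> y" using e(1) j by (simp add: strict_mono_less_eq)
      qed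
    qed
    then have "mq_top a D ` {1..n} = e ` first_positions n (a \<circ> e)"
      by (auto simp: first_positions_def image_image)
    moreover have "sorted_list_of_set (e ` A) = map e (sorted_list_of_set A)" if "finite A" for A
    proof (rule strict_sorted_equal)
      show "sorted_wrt (<) (map e (sorted_list_of_set A))"
        using e(1) strict_sorted_list_of_set[of A] by (simp add: sorted_wrt_map strict_mono_less)
    qed (use that in auto)
    ultimately show ?thesis
      by (simp add: mq_tops_def) (simp add: first_positions_def)
  qed
  show ?thesis
  proof (induction s)
    case 0
    then show ?case using tops[of id "{}"] a by (intro exI[of _ id]) (auto simp: strict_mono_def)
  next
    case (Suc s)
    let ?D = "mq_deleted n a c s" and ?b = "remaining n a c s"
    let ?J = "first_positions n ?b"
    from Suc obtain e where e: "strict_mono e" "range e = - ?D" "a \<circ> e = ?b"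
      "mq_tops n a ?D = map e (sorted_list_of_set ?J)" by blast
    have J: "finite ?J" "card ?J = n"
      using first_positions_top_sets[OF recurrent_remaining[OF a]] by (auto simp: top_sets_def)
    let ?p = "sorted_list_of_set ?J ! (c s - 1)"
    let ?e = "remove_at ?p e"
    have D: "mq_deleted n a c (Suc s) = insert (e ?p) ?D"
      using J c[of s] by (auto simp: e(4))
    have mono: "strict_mono ?e"
      using e(1) by (auto simp: strict_mono_def remove_at_def)
    have "range ?e = range e - {e ?p}"
    proof safe
      fix k assume "e k \<notin> range ?e"
      then show "e k = e ?p"
        by (cases k "?p" rule: linorder_cases)
           (auto simp: remove_at_def image_iff dest: spec[of _ k] spec[of _ "k - 1"])
    qed (use strict_mono_eq[OF e(1)] in \<open>auto simp: remove_at_def split: if_splits\<close>)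
    then have range: "range ?e = - mq_deleted n a c (Suc s)" using e(2) D by auto
    have comp: "a \<circ> ?e = remaining n a c (Suc s)"
      using e(3) by (auto simp: delete_label_def remove_at_def fun_eq_iff)
    have "mq_tops n a (mq_deleted n a c (Suc s))
        = map ?e (sorted_list_of_set (first_positions n (remaining n a c (Suc s))))"
      using tops[OF mono range] recurrent_remaining[OF a, of c "Suc s"] unfolding comp by blast
    then show ?case using mono range comp by blast
  qed
qed

text \<open>Since \<open>e\<close> enumerates the remaining elements increasingly from index 0, the
  element \<open>e k\<close> has rank \<open>Suc k\<close>.\<close>

lemma mq_ranks_eq:
  assumes a: "recurrent n a" and c: "\<And>s. c s \<in> {1..n}"
  shows "mq_ranks n a c s = map Suc (sorted_list_of_set (first_positions n (remaining n a c s)))"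
proof -
  let ?D = "mq_deleted n a c s" and ?b = "remaining n a c s"
  let ?l = "sorted_list_of_set (first_positions n ?b)"
  obtain e where e: "strict_mono e" "range e = - ?D" "mq_tops n a ?D = map e ?l"
    using remaining_enumerates[where n = n and a = a and c = c and s = s, OF assms] by blast
  have len: "length ?l = n"
    using first_positions_top_sets[OF recurrent_remaining[OF a]] by (auto simp: top_sets_def)
  have "mq_rank n a ?D (Suc i) = Suc (?l ! i)" if "i < n" for i
  proof -
    have "{k. k \<notin> ?D \<and> k \<le> e (?l ! i)} = e ` {..?l ! i}"
    proof safe
      fix k assume "k \<notin> ?D" "k \<le> e (?l ! i)"
      then obtain j where "k = e j" using e(2) by blast
      then show "k \<in> e ` {..?l ! i}" using \<open>k \<le> _\<close> e(1) by (auto simp: strict_mono_less_eq)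
    qed (use e in \<open>auto simp: strict_mono_less_eq\<close>)
    then show ?thesis
      using that len e(3) strict_mono_imp_inj_on[OF e(1)] 
      by (simp add: mq_rank_def card_image inj_on_subset)
  qed
  then show ?thesis
    using len by (intro nth_equalityI) (auto simp: mq_ranks_def simp del: upt_Suc)
qed

section \<open>Adjointness of deletion and insertion\<close>

lemma measurable_map_list:
  fixes f :: "'b \<Rightarrow> 'a \<Rightarrow> 'c :: countable"
  assumes "\<And>x. x \<in> set xs \<Longrightarrow> f x \<in> M \<rightarrow>\<^sub>M count_space UNIV"
  shows "(\<lambda>\<omega>. map (\<lambda>x. f x \<omega>) xs) \<in> M \<rightarrow>\<^sub>M count_space UNIV"
  using assms
proof (induction xs)
  case (Cons x xs)
  then have [measurable]: "f x \<in> M \<rightarrow>\<^sub>M count_space UNIV"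
    "(\<lambda>\<omega>. map (\<lambda>x. f x \<omega>) xs) \<in> M \<rightarrow>\<^sub>M count_space UNIV" by auto
  have "(\<lambda>\<omega>. (\<lambda>y \<omega>. y # map (\<lambda>x. f x \<omega>) xs) (f x \<omega>) \<omega>) \<in> M \<rightarrow>\<^sub>M count_space UNIV"
    by (rule measurable_compose_countable) measurable
  then show ?case by simp
qed simp

lemma measurable_first_positions [measurable]:
  "first_positions n \<in> seq_space \<rightarrow>\<^sub>M count_space UNIV"
proof -
  have "(\<lambda>b. map (\<lambda>q. mq_top b {} q) [1..<Suc n]) \<in> seq_space \<rightarrow>\<^sub>M count_space UNIV"
    unfolding mq_top_def by (rule measurable_map_list) measurable
  then have "(\<lambda>b. set (map (\<lambda>q. mq_top b {} q) [1..<Suc n])) \<in> seq_space \<rightarrow>\<^sub>M count_space UNIV"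
    by (rule measurable_compose) simp
  then show ?thesis by (simp add: first_positions_def[abs_def] atLeastLessThanSuc_atLeastAtMost del: upt_Suc)
qed

lemma measurable_prefix:
  fixes g :: "'a :: countable list \<Rightarrow> 'c"
  assumes "range g \<subseteq> space N"
  shows "(\<lambda>b. g (map b [0..<m])) \<in> seq_space \<rightarrow>\<^sub>M N"
proof -
  have "(\<lambda>b. map (\<lambda>i. b i) [0..<m]) \<in> (seq_space :: (nat \<Rightarrow> 'a) measure) \<rightarrow>\<^sub>M count_space UNIV"
    by (rule measurable_map_list) measurable
  then show ?thesis by (rule measurable_compose) (use assms in auto)
qed

lemma measurable_delete_label [measurable]: "delete_label n i \<in> seq_space \<rightarrow>\<^sub>M seq_space"
proof -
  have pos: "(\<lambda>b. sorted_list_of_set (first_positions n b) ! (i - 1)) \<in> seq_space \<rightarrow>\<^sub>M count_space UNIV"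
    by (rule measurable_compose[OF measurable_first_positions]) simp
  show ?thesis
    unfolding delete_label_def[abs_def] by (rule measurable_compose_countable[OF _ pos]) measurable
qed

lemma measurable_remaining [measurable]:
  "(\<lambda>(a, c). remaining n a c s) \<in> seq_space \<Otimes>\<^sub>M seq_space \<rightarrow>\<^sub>M seq_space"
proof (induction s)
  case (Suc s)
  then have [measurable]: "(\<lambda>x. remaining n (fst x) (snd x) s) \<in> seq_space \<Otimes>\<^sub>M seq_space \<rightarrow>\<^sub>M seq_space"
    by (simp add: split_beta')
  have "(\<lambda>x. (\<lambda>i x. delete_label n i (remaining n (fst x) (snd x) s)) (snd x s) x)
      \<in> seq_space \<Otimes>\<^sub>M seq_space \<rightarrow>\<^sub>M seq_space"
    by (rule measurable_compose_countable) measurable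
  then show ?case by (simp add: split_beta')
qed (simp add: split_beta')

lemma measurable_mq_ranks:
  "(\<lambda>\<omega>. mq_ranks n (fst \<circ> \<omega>) (snd \<circ> \<omega>) s) \<in> seq_space \<rightarrow>\<^sub>M count_space UNIV"
proof -
  have fst_snd [measurable]: "(\<lambda>\<omega>. fst (\<omega> k)) \<in> seq_space \<rightarrow>\<^sub>M count_space UNIV"
    "(\<lambda>\<omega>. snd (\<omega> k)) \<in> seq_space \<rightarrow>\<^sub>M count_space UNIV" for k :: nat
    by (rule measurable_compose[OF measurable_component_singleton], auto)+
  have tops: "(\<lambda>\<omega>. mq_tops n (fst \<circ> \<omega>) D) \<in> seq_space \<rightarrow>\<^sub>M count_space UNIV" for D
  proof -
    have "(\<lambda>\<omega>. map (\<lambda>q. mq_top (fst \<circ> \<omega>) D q) [1..<Suc n]) \<in> seq_space \<rightarrow>\<^sub>M count_space UNIV"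
      unfolding mq_top_def comp_def by (rule measurable_map_list) measurable
    then have "(\<lambda>\<omega>. sorted_list_of_set (set (map (\<lambda>q. mq_top (fst \<circ> \<omega>) D q) [1..<Suc n])))
        \<in> seq_space \<rightarrow>\<^sub>M count_space UNIV"
      by (rule measurable_compose) simp
    then show ?thesis by (simp add: mq_tops_def[abs_def] atLeastLessThanSuc_atLeastAtMost del: upt_Suc)
  qed
  \<comment> \<open>The deleted sets are treated as values in the space of finite sets, which is
    countable, so that the maps can be composed value by value.\<close>
  have deleted: "(\<lambda>\<omega>. mq_deleted n (fst \<circ> \<omega>) (snd \<circ> \<omega>) s) \<in> seq_space \<rightarrow>\<^sub>M count_space {D. finite D}"
  proof (induction s)
    case (Suc s)
    have "(\<lambda>\<omega>. (\<lambda>D \<omega>. insert (mq_tops n (fst \<circ> \<omega>) D ! (snd (\<omega> s) - 1)) D)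
        (mq_deleted n (fst \<circ> \<omega>) (snd \<circ> \<omega>) s) \<omega>) \<in> seq_space \<rightarrow>\<^sub>M count_space {D. finite D}"
    proof (rule measurable_compose_countable'[OF _ Suc countable_Collect_finite])
      fix D :: "nat set" assume D: "D \<in> {D. finite D}"
      have "(\<lambda>\<omega>. (\<lambda>i \<omega>. insert (mq_tops n (fst \<circ> \<omega>) D ! (i - 1)) D) (snd (\<omega> s)) \<omega>)
          \<in> seq_space \<rightarrow>\<^sub>M count_space {D. finite D}"
        by (rule measurable_compose_countable, rule measurable_compose[OF tops]) (use D fst_snd in auto)
      then show "(\<lambda>\<omega>. insert (mq_tops n (fst \<circ> \<omega>) D ! (snd (\<omega> s) - 1)) D)
          \<in> seq_space \<rightarrow>\<^sub>M count_space {D. finite D}" by simp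
    qed
    then show ?case by (simp add: comp_def)
  qed simp
  have "(\<lambda>\<omega>. (\<lambda>D \<omega>. map (mq_rank n (fst \<circ> \<omega>) D) [1..<n+1]) (mq_deleted n (fst \<circ> \<omega>) (snd \<circ> \<omega>) s) \<omega>)
      \<in> seq_space \<rightarrow>\<^sub>M count_space UNIV"
    unfolding mq_rank_def
    by (rule measurable_compose_countable'[OF _ deleted countable_Collect_finite], rule measurable_compose[OF tops]) simp
  then show ?thesis by (simp add: mq_ranks_def[abs_def])
qed

section \<open>The transition operator and its adjoint\<close>

context multiqueue
begin

abbreviation labels :: "(nat \<Rightarrow> nat) measure" where
  "labels \<equiv> iid (pmf_of_set {1..n})"

lemma set_label [simp]: "set_pmf (pmf_of_set {Suc 0..n}) = {Suc 0..n}"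
  using n_pos by (intro set_pmf_of_set) auto

lemma AE_recurrent: "AE b in labels. recurrent n b"
proof -
  have "AE b in labels. b k \<in> {1..n}" for k
    by (rule AE_PiM_component) (auto simp: measure_pmf.prob_space_axioms AE_measure_pmf_iff)
  moreover have "AE b in labels. \<forall>q\<in>{1..n}. infinite {k. b k = q}"
    by (intro eventually_ball_finite ballI AE_iid_infinitely_often) auto
  ultimately have "AE b in labels. (\<forall>k. b k \<in> {1..n}) \<and> (\<forall>q\<in>{1..n}. infinite {k. b k = q})"
    by (simp add: AE_all_countable)
  then show ?thesis by eventually_elim (auto simp: recurrent_def)
qed

definition step_op :: "((nat \<Rightarrow> nat) \<Rightarrow> ennreal) \<Rightarrow> (nat \<Rightarrow> nat) \<Rightarrow> ennreal" where
  "step_op F b = (\<Sum>i=1..n. ennreal (pmf \<sigma> i) * F (delete_label n i b))"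

lemma measurable_step_op:
  assumes [measurable]: "F \<in> borel_measurable seq_space"
  shows "step_op F \<in> borel_measurable seq_space"
  unfolding step_op_def[abs_def] by measurable

lemma nn_integral_sigma: "(\<integral>\<^sup>+i. f i \<partial>\<sigma>) = (\<Sum>i=1..n. ennreal (pmf \<sigma> i) * f i)"
  using supp by (subst nn_integral_measure_pmf_support[of "{1..n}"]) (auto simp: mult.commute)

lemma nn_integral_label: "(\<integral>\<^sup>+q. f q \<partial>measure_pmf (pmf_of_set {1..n})) = (\<Sum>q=1..n. ennreal (1 / real n) * f q)"
  using n_pos by (subst nn_integral_measure_pmf_support[of "{1..n}"]) (auto simp: mult.commute)

text \<open>A deletion at position \<open>p\<close> is undone by inserting a fresh label at \<open>p\<close>, and inserting an
  independent uniform label preserves the uniform measure.\<close>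

lemma step_op_adjoint:
  assumes [measurable]: "F \<in> borel_measurable seq_space"
  shows "(\<integral>\<^sup>+b. step_op F b * \<phi> (first_positions n b) \<partial>labels)
       = (\<integral>\<^sup>+b. F b * reverse_op \<phi> (first_positions n b) \<partial>labels)"
proof -
  let ?J = "first_positions n"
  \<comment> \<open>\<open>Z p b\<close> is the probability that the next deletion hits position
    \<open>p\<close>. It depends on a prefix of \<open>b\<close> only, hence is measurable, and it
    vanishes off the first appearances. The sum over the random set of tops thus becomes a sum over
    all \<open>p\<close>, which can be exchanged with the integral.\<close>
  define Z where "Z p b = (if b p \<notin> b ` {..<p} then ennreal (pmf \<sigma> (Suc (card (b ` {..<p})))) else 0)"
    for p and b :: "nat \<Rightarrow> nat"
  have Z_meas [measurable]: "Z p \<in> borel_measurable seq_space" for p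
  proof -
    define g where "g xs = (if xs ! p \<notin> set (take p xs) then ennreal (pmf \<sigma> (Suc (card (set (take p xs))))) else 0)"
      for xs :: "nat list"
    have "Z p = (\<lambda>b. g (map b [0..<Suc p]))"
      by (simp add: fun_eq_iff Z_def g_def take_map atLeast0LessThan nth_append)
    then show ?thesis by (simp only:) (rule measurable_prefix, simp)
  qed
  have \<phi>_meas [measurable]: "(\<lambda>b. \<phi> (?J b)) \<in> borel_measurable seq_space"
    by (rule measurable_compose[OF measurable_first_positions]) simp
  have ins_meas [measurable]: "insert_at p q \<in> seq_space \<rightarrow>\<^sub>M seq_space" for p and q :: nat
    by (rule measurable_PiM_single') (auto simp: insert_at_def)
  have "(\<integral>\<^sup>+b. step_op F b * \<phi> (?J b) \<partial>labels)
      = (\<integral>\<^sup>+b. (\<Sum>p. Z p b * F (remove_at p b) * \<phi> (?J b)) \<partial>labels)"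
  proof (rule nn_integral_cong_AE, use AE_recurrent in eventually_elim)
    fix b assume b: "recurrent n b"
    have fin: "finite (?J b)" using first_positions_top_sets[OF b] by (simp add: top_sets_def)
    have "(\<Sum>p. Z p b * F (remove_at p b) * \<phi> (?J b)) = (\<Sum>p\<in>?J b. Z p b * F (remove_at p b) * \<phi> (?J b))"
      using fin by (intro suminf_finite) (auto simp: Z_def first_positions_iff[OF b])
    also have "\<dots> = (\<Sum>p\<in>?J b. ennreal (pmf \<sigma> (Suc (before (?J b) p))) * F (remove_at p b)) * \<phi> (?J b)"
      unfolding sum_distrib_right
      by (intro sum.cong refl) (auto simp: Z_def first_positions_iff[OF b] before_first_positions[OF b])
    also have "\<dots> = step_op F b * \<phi> (?J b)"
      unfolding step_op_def sum_delete_label[OF b, of "\<lambda>i. ennreal (pmf \<sigma> i)" F] ..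
    finally show "step_op F b * \<phi> (?J b) = (\<Sum>p. Z p b * F (remove_at p b) * \<phi> (?J b))" ..
  qed
  also have "\<dots> = (\<Sum>p. \<integral>\<^sup>+b. Z p b * F (remove_at p b) * \<phi> (?J b) \<partial>labels)"
    by (intro nn_integral_suminf) measurable
  also have "\<dots> = (\<Sum>p. \<integral>\<^sup>+b. (\<Sum>q=1..n. ennreal (1 / real n) * (Z p (insert_at p q b) * F b * \<phi> (?J (insert_at p q b)))) \<partial>labels)"
  proof -
    have "(\<integral>\<^sup>+b. Z p b * F (remove_at p b) * \<phi> (?J b) \<partial>labels)
        = (\<integral>\<^sup>+b. (\<Sum>q=1..n. ennreal (1 / real n) * (Z p (insert_at p q b) * F b * \<phi> (?J (insert_at p q b)))) \<partial>labels)" for p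
      by (subst nn_integral_iid_insert_at[where p = p]) (measurable, simp only: nn_integral_label remove_at_insert_at)
    then show ?thesis by simp
  qed
  also have "\<dots> = (\<integral>\<^sup>+b. (\<Sum>p. \<Sum>q=1..n. ennreal (1 / real n) * (Z p (insert_at p q b) * F b * \<phi> (?J (insert_at p q b)))) \<partial>labels)"
    by (intro nn_integral_suminf[symmetric]) measurable
  also have "\<dots> = (\<integral>\<^sup>+b. F b * reverse_op \<phi> (?J b) \<partial>labels)"
  proof (rule nn_integral_cong_AE, use AE_recurrent in eventually_elim)
    fix b assume b: "recurrent n b"
    let ?t = "mq_top b {}"
    have J: "finite (?J b)" using first_positions_top_sets[OF b] by (simp add: top_sets_def)
    \<comment> \<open>A label \<open>q\<close> inserted at \<open>p\<close> is fresh there exactly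
      if \<open>p\<close> does not exceed its former first appearance \<open>mq_top b {} q\<close>.
      The truncation in \<open>w\<close> encodes this.\<close>
    define w where "w p q = (if p \<le> ?t q then ennreal (pmf \<sigma> (Suc (before (?J b) p)) / real n) * \<phi> (pushed (?J b) p (?t q)) else 0)"
      for p q
    have w: "ennreal (1 / real n) * (Z p (insert_at p q b) * F b * \<phi> (?J (insert_at p q b))) = F b * w p q"
      if q: "q \<in> {1..n}" for p q
    proof -
      have img: "insert_at p q b ` {..<p} = b ` {..<p}" "insert_at p q b p = q"
        by (auto simp: insert_at_def intro!: image_cong)
      show ?thesis
      proof (cases "p \<le> ?t q")
        case True
        then have nq: "q \<notin> b ` {..<p}" using not_seen_iff[OF b q] by blast
        have "ennreal (1 / real n) * ennreal (pmf \<sigma> (Suc (before (?J b) p))) = ennreal (pmf \<sigma> (Suc (before (?J b) p)) / real n)"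
          by (simp add: ennreal_mult[symmetric])
        then show ?thesis
          using True nq
          by (simp add: w_def Z_def img first_positions_insert_at[OF b q nq] before_first_positions[OF b]
               mult.left_commute[of _ "F b"] mult.assoc flip: mult.assoc[of "ennreal (1 / _)"])
      next
        case False
        then have "q \<in> b ` {..<p}" using not_seen_iff[OF b q] by blast
        then show ?thesis using False by (simp add: w_def Z_def img)
      qed
    qed
    have bnd: "?t q \<le> Max (?J b)" if "q \<in> {1..n}" for q
      using J that by (intro Max_ge) (auto simp: first_positions_def)
    have "(\<Sum>p. \<Sum>q=1..n. ennreal (1 / real n) * (Z p (insert_at p q b) * F b * \<phi> (?J (insert_at p q b))))
        = (\<Sum>p. \<Sum>q=1..n. F b * w p q)"
      using w by simp
    also have "\<dots> = (\<Sum>p\<le>Max (?J b). \<Sum>q=1..n. F b * w p q)"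
    proof (rule suminf_finite)
      fix p assume "p \<notin> {..Max (?J b)}"
      then have "w p q = 0" if "q \<in> {1..n}" for q using bnd[OF that] by (auto simp: w_def)
      then show "(\<Sum>q=1..n. F b * w p q) = 0" by simp
    qed simp
    also have "\<dots> = F b * (\<Sum>q=1..n. \<Sum>p\<le>Max (?J b). w p q)"
      by (subst sum.swap) (simp add: sum_distrib_left)
    also have "(\<Sum>q=1..n. \<Sum>p\<le>Max (?J b). w p q)
        = (\<Sum>q=1..n. \<Sum>p\<le>?t q. ennreal (pmf \<sigma> (Suc (before (?J b) p)) / real n) * \<phi> (pushed (?J b) p (?t q)))"
    proof (rule sum.cong[OF refl])
      fix q assume q: "q \<in> {1..n}"
      have "(\<Sum>p\<le>Max (?J b). w p q) = (\<Sum>p\<le>?t q. w p q)"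
        using bnd[OF q] by (intro sum.mono_neutral_right) (auto simp: w_def)
      then show "(\<Sum>p\<le>Max (?J b). w p q)
        = (\<Sum>p\<le>?t q. ennreal (pmf \<sigma> (Suc (before (?J b) p)) / real n) * \<phi> (pushed (?J b) p (?t q)))"
        by (simp add: w_def)
    qed
    \<comment> \<open>Distinct labels have distinct first appearances, so the sum over
      \<open>q\<close> becomes the sum over \<open>f\<close> in
      \<open>first_positions n b\<close>.\<close>
    also have "\<dots> = reverse_op \<phi> (?J b)"
      unfolding reverse_op_def first_positions_def sum.reindex[OF inj_on_mq_top[OF b]] comp_def ..
    finally show "(\<Sum>p. \<Sum>q=1..n. ennreal (1 / real n) * (Z p (insert_at p q b) * F b * \<phi> (?J (insert_at p q b))))
       = F b * reverse_op \<phi> (?J b)" .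
  qed
  finally show ?thesis .
qed

lemma step_op_iterate_adjoint:
  assumes F: "F \<in> borel_measurable seq_space"
  shows "(\<integral>\<^sup>+b. (step_op ^^ s) F b * \<phi> (first_positions n b) \<partial>labels)
       = (\<integral>\<^sup>+b. F b * (reverse_op ^^ s) \<phi> (first_positions n b) \<partial>labels)"
proof (induction s arbitrary: \<phi>)
  case (Suc s)
  have "(step_op ^^ s) F \<in> borel_measurable seq_space"
    by (induction s) (auto intro: F measurable_step_op)
  then have "(\<integral>\<^sup>+b. (step_op ^^ Suc s) F b * \<phi> (first_positions n b) \<partial>labels)
      = (\<integral>\<^sup>+b. (step_op ^^ s) F b * reverse_op \<phi> (first_positions n b) \<partial>labels)"
    unfolding funpow.simps comp_apply by (rule step_op_adjoint)
  also have "\<dots> = (\<integral>\<^sup>+b. F b * (reverse_op ^^ Suc s) \<phi> (first_positions n b) \<partial>labels)"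
    unfolding funpow_Suc_right comp_apply by (rule Suc.IH)
  finally show ?case .
qed simp

lemma nn_integral_remaining:
  assumes [measurable]: "F \<in> borel_measurable seq_space"
  shows "(\<integral>\<^sup>+c. F (remaining n a c s) \<partial>iid \<sigma>) = (step_op ^^ s) F a"
proof (induction s arbitrary: a)
  case 0
  interpret prob_space "iid \<sigma>" by (rule prob_space_iid)
  show ?case using emeasure_space_1 by simp
next
  case (Suc s)
  have [measurable]: "(\<lambda>c. remaining n a c s) \<in> seq_space \<rightarrow>\<^sub>M seq_space" for a s
    using measurable_compose[OF measurable_Pair1' measurable_remaining[of n s], of a]
    by (simp add: space_PiM)
  have "(\<integral>\<^sup>+c. F (remaining n a c (Suc s)) \<partial>iid \<sigma>)
      = (\<integral>\<^sup>+c. \<integral>\<^sup>+i. F (remaining n a (insert_at 0 i c) (Suc s)) \<partial>\<sigma> \<partial>iid \<sigma>)"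
    by (rule nn_integral_iid_insert_at) measurable
  also have "\<dots> = (\<integral>\<^sup>+c. (\<Sum>i=1..n. ennreal (pmf \<sigma> i) * F (remaining n (delete_label n i a) c s)) \<partial>iid \<sigma>)"
    unfolding remaining_Suc_shift nn_integral_sigma by (simp add: insert_at_def[abs_def] comp_def)
  also have "\<dots> = (\<Sum>i=1..n. ennreal (pmf \<sigma> i) * (\<integral>\<^sup>+c. F (remaining n (delete_label n i a) c s) \<partial>iid \<sigma>))"
    by (simp add: nn_integral_sum nn_integral_cmult)
  also have "\<dots> = (step_op ^^ Suc s) F a"
    by (simp add: Suc step_op_def[of "(step_op ^^ s) F"])
  finally show ?case .
qed

text \<open>The initial sequence is uniform, so its density is the constant 1. Moving all
  \<open>s\<close> deletions to the density side shows that the \<open>s\<close>-th iterate of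
  \<open>reverse_op\<close> on this constant is the density after \<open>s\<close>
  deletions.\<close>

lemma nn_integral_mq_ranks:
  "(\<integral>\<^sup>+\<omega>. g (mq_ranks n (fst \<circ> \<omega>) (snd \<circ> \<omega>) s) \<partial>mq_space n \<sigma>)
   = (\<integral>\<^sup>+b. g (map Suc (sorted_list_of_set (first_positions n b)))
        * (reverse_op ^^ s) (\<lambda>_. 1) (first_positions n b) \<partial>labels)"
proof -
  interpret A: prob_space labels by (rule prob_space_iid)
  interpret B: prob_space "iid \<sigma>" by (rule prob_space_iid)
  interpret AB: pair_prob_space labels "iid \<sigma>" ..
  have pairing [measurable]: "(\<lambda>(a, c) k. (a k, c k)) \<in> labels \<Otimes>\<^sub>M iid \<sigma> \<rightarrow>\<^sub>M iid (pair_pmf (pmf_of_set {1..n}) \<sigma>)"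
    unfolding split_beta by (rule measurable_PiM_single') auto
  have ranks [measurable]: "(\<lambda>\<omega>. g (mq_ranks n (fst \<circ> \<omega>) (snd \<circ> \<omega>) s)) \<in> borel_measurable seq_space"
    by (rule measurable_compose[OF measurable_mq_ranks]) simp
  define G where "G b = g (map Suc (sorted_list_of_set (first_positions n b)))" for b
  have G [measurable]: "G \<in> borel_measurable seq_space"
    unfolding G_def[abs_def] by (rule measurable_compose[OF measurable_first_positions]) simp
  have ranks': "(\<lambda>\<omega>. g (mq_ranks n (fst \<circ> \<omega>) (snd \<circ> \<omega>) s)) \<in> borel_measurable (iid (pair_pmf (pmf_of_set {1..n}) \<sigma>))"
    by measurable
  have "(\<integral>\<^sup>+\<omega>. g (mq_ranks n (fst \<circ> \<omega>) (snd \<circ> \<omega>) s) \<partial>mq_space n \<sigma>)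
      = (\<integral>\<^sup>+\<omega>. g (mq_ranks n (fst \<circ> \<omega>) (snd \<circ> \<omega>) s)
          \<partial>distr (labels \<Otimes>\<^sub>M iid \<sigma>) (iid (pair_pmf (pmf_of_set {1..n}) \<sigma>)) (\<lambda>(a, c) k. (a k, c k)))"
    unfolding mq_space_def distr_iid_pair ..
  also have "\<dots> = (\<integral>\<^sup>+x. g (mq_ranks n (fst x) (snd x) s) \<partial>(labels \<Otimes>\<^sub>M iid \<sigma>))"
    using ranks' by (subst nn_integral_distr[OF pairing]) (auto simp: split_beta' comp_def)
  also have "\<dots> = (\<integral>\<^sup>+a. \<integral>\<^sup>+c. g (mq_ranks n a c s) \<partial>iid \<sigma> \<partial>labels)"
  proof (subst B.nn_integral_fst[symmetric])
    show "(\<lambda>x. g (mq_ranks n (fst x) (snd x) s)) \<in> borel_measurable (labels \<Otimes>\<^sub>M iid \<sigma>)"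
      using measurable_compose[OF pairing ranks'] by (simp add: split_beta' comp_def)
  qed simp
  also have "\<dots> = (\<integral>\<^sup>+a. \<integral>\<^sup>+c. G (remaining n a c s) \<partial>iid \<sigma> \<partial>labels)"
  proof (rule nn_integral_cong_AE, use AE_recurrent in eventually_elim, rule nn_integral_cong_AE)
    fix a assume a: "recurrent n a"
    have "AE c in iid \<sigma>. c k \<in> {1..n}" for k
      by (rule AE_PiM_component) (use supp in \<open>auto simp: measure_pmf.prob_space_axioms AE_measure_pmf_iff\<close>)
    then have "AE c in iid \<sigma>. \<forall>k. c k \<in> {1..n}" by (simp add: AE_all_countable)
    then show "AE c in iid \<sigma>. g (mq_ranks n a c s) = G (remaining n a c s)"
      by eventually_elim (simp add: mq_ranks_eq[OF a] G_def)
  qed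
  also have "\<dots> = (\<integral>\<^sup>+b. G b * (reverse_op ^^ s) (\<lambda>_. 1) (first_positions n b) \<partial>labels)"
    using step_op_iterate_adjoint[OF G, of s "\<lambda>_. 1"] by (simp add: nn_integral_remaining[OF G])
  finally show ?thesis by (simp add: G_def)
qed

end

section \<open>The stationary law and convergence\<close>

definition partial_sum :: "(nat \<Rightarrow> nat) \<Rightarrow> nat \<Rightarrow> nat" where
  "partial_sum \<delta> i = (\<Sum>j\<in>{1..<i}. \<delta> j)"

lemma partial_sum_1 [simp]: "partial_sum \<delta> (Suc 0) = 0"
  by (simp add: partial_sum_def)

lemma partial_sum_Suc: "0 < i \<Longrightarrow> partial_sum \<delta> (Suc i) = partial_sum \<delta> i + \<delta> i"
  by (simp add: partial_sum_def)

text \<open>Entries outside \<open>{1..<n}\<close> are 0, the default value of \<open>Pi_pmf\<close>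
  in the limit law. With this convention a set of tops determines its gap vector.\<close>

definition gap_vectors :: "nat \<Rightarrow> (nat \<Rightarrow> nat) set" where
  "gap_vectors n = {\<delta>. (\<forall>j\<in>{1..<n}. 0 < \<delta> j) \<and> (\<forall>j. j \<notin> {1..<n} \<longrightarrow> \<delta> j = 0)}"

lemma partial_sum_less:
  assumes "\<delta> \<in> gap_vectors n" "0 < i" "i < j" "j \<le> n"
  shows "partial_sum \<delta> i < partial_sum \<delta> j"
  using assms(3,4)
proof (induction j)
  case (Suc j)
  have "0 < \<delta> j" using Suc.prems assms by (auto simp: gap_vectors_def)
  then show ?case using Suc assms(2) by (cases "i = j") (auto simp: partial_sum_Suc)
qed simp

lemma partial_sum_less_iff:
  assumes "\<delta> \<in> gap_vectors n" "i \<in> {1..n}" "j \<in> {1..n}"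
  shows "partial_sum \<delta> i < partial_sum \<delta> j \<longleftrightarrow> i < j"
  using partial_sum_less[OF assms(1), of i j] partial_sum_less[OF assms(1), of j i] assms(2,3)
  by (cases i j rule: linorder_cases) auto

lemma inj_on_partial_sum: "\<delta> \<in> gap_vectors n \<Longrightarrow> inj_on (partial_sum \<delta>) {1..n}"
  by (rule linorder_inj_onI) (use partial_sum_less_iff[of \<delta> n] in \<open>fastforce+\<close>)

lemma sorted_list_of_partial_sums:
  assumes "\<delta> \<in> gap_vectors n"
  shows "sorted_list_of_set (partial_sum \<delta> ` {1..n}) = map (partial_sum \<delta>) [1..<n+1]"
proof (rule strict_sorted_equal)
  have "sorted_wrt (\<lambda>x y. partial_sum \<delta> x < partial_sum \<delta> y) [1..<n+1]"
    by (rule sorted_wrt_mono_rel[of _ "(<)"])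
       (use partial_sum_less_iff[OF assms] in \<open>auto simp: sorted_wrt_upt simp del: upt_Suc\<close>)
  then show "sorted_wrt (<) (map (partial_sum \<delta>) [1..<n+1])" by (simp add: sorted_wrt_map del: upt_Suc)
qed auto

lemma partial_sums_top_sets:
  assumes "\<delta> \<in> gap_vectors n" "0 < n"
  shows "partial_sum \<delta> ` {1..n} \<in> top_sets n"
  using card_image[OF inj_on_partial_sum[OF assms(1)]] assms(2)
  by (auto simp: top_sets_def intro!: image_eqI[of _ _ 1])

lemma partial_sum_eqD:
  assumes "\<delta> \<in> gap_vectors n" "\<delta>' \<in> gap_vectors n" "partial_sum \<delta> ` {1..n} = partial_sum \<delta>' ` {1..n}"
  shows "\<delta> = \<delta>'"
proof
  fix j
  have "map (partial_sum \<delta>) [1..<n+1] = map (partial_sum \<delta>') [1..<n+1]"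
    using assms sorted_list_of_partial_sums[of _ n] by metis
  then have *: "partial_sum \<delta> i = partial_sum \<delta>' i" if "i \<in> {1..n}" for i
    using that unfolding map_eq_conv by (auto simp del: upt_Suc)
  show "\<delta> j = \<delta>' j"
  proof (cases "j \<in> {1..<n}")
    case True
    then show ?thesis using *[of j] *[of "Suc j"] by (auto simp: partial_sum_Suc)
  qed (use assms in \<open>auto simp: gap_vectors_def\<close>)
qed

lemma top_sets_partial_sums:
  assumes "J \<in> top_sets n"
  obtains \<delta> where "\<delta> \<in> gap_vectors n" "J = partial_sum \<delta> ` {1..n}"
proof
  let ?l = "sorted_list_of_set J"
  define \<delta> where "\<delta> j = (if j \<in> {1..<n} then ?l ! j - ?l ! (j - 1) else 0)" for j
  have J: "finite J" "card J = n" "0 \<in> J" using assms by (auto simp: top_sets_def)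
  have l: "length ?l = n" "set ?l = J" "sorted_wrt (<) ?l" using J by auto
  have less: "?l ! (j - 1) < ?l ! j" if "j \<in> {1..<n}" for j
    using sorted_wrt_nth_less[OF l(3), of "j - 1" j] that l by auto
  show "\<delta> \<in> gap_vectors n" using less by (auto simp: gap_vectors_def \<delta>_def)
  have n: "0 < n" using J by (auto simp: card_gt_0_iff)
  \<comment> \<open>The partial sums start at 0, so recovering \<open>J\<close> from its gaps uses
    that its least element is 0.\<close>
  have first: "?l ! 0 = 0"
  proof -
    obtain k where k: "k < n" "?l ! k = 0" using J l by (metis in_set_conv_nth)
    then show ?thesis using sorted_wrt_nth_less[OF l(3), of 0 k] l by (cases "k = 0") auto
  qed
  have "partial_sum \<delta> (Suc i) = ?l ! i" if "i < n" for i
    using that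
  proof (induction i)
    case (Suc i)
    then show ?case using less[of "Suc i"] by (simp add: partial_sum_Suc \<delta>_def)
  qed (simp add: first)
  then have "map (partial_sum \<delta>) [1..<n+1] = ?l"
    using l by (intro nth_equalityI) (auto simp del: upt_Suc)
  then have "set (map (partial_sum \<delta>) [1..<n+1]) = J" using l by simp
  then show "J = partial_sum \<delta> ` {1..n}" by (auto simp del: upt_Suc)
qed

text \<open>Positions are grouped into the gaps between consecutive tops. On each gap the number of
  labels seen is constant, by \<open>before_partial_sums\<close>, which makes such products
  computable.\<close>

lemma prod_over_gaps:
  fixes t :: "nat \<Rightarrow> 'a :: comm_monoid_mult"
  shows "(\<Prod>k=1..partial_sum \<delta> (Suc i). t k)
       = (\<Prod>j\<in>{1..<Suc i}. \<Prod>k\<in>{partial_sum \<delta> j<..partial_sum \<delta> (Suc j)}. t k)"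
proof (induction i)
  case (Suc i)
  have "{1..partial_sum \<delta> (Suc (Suc i))}
      = {1..partial_sum \<delta> (Suc i)} \<union> {partial_sum \<delta> (Suc i)<..partial_sum \<delta> (Suc (Suc i))}"
    by (auto simp: partial_sum_Suc)
  then have "(\<Prod>k=1..partial_sum \<delta> (Suc (Suc i)). t k)
      = (\<Prod>k=1..partial_sum \<delta> (Suc i). t k) * (\<Prod>k\<in>{partial_sum \<delta> (Suc i)<..partial_sum \<delta> (Suc (Suc i))}. t k)"
    by (simp only:) (rule prod.union_disjoint, auto)
  also have "\<dots> = (\<Prod>j\<in>{1..<Suc (Suc i)}. \<Prod>k\<in>{partial_sum \<delta> j<..partial_sum \<delta> (Suc j)}. t k)"
    unfolding Suc.IH by (rule prod.atLeastLessThan_Suc[symmetric]) simp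
  finally show ?case .
qed simp

lemma before_partial_sums:
  assumes "\<delta> \<in> gap_vectors n" "j \<in> {1..<n}" "k \<in> {partial_sum \<delta> j<..partial_sum \<delta> (Suc j)}"
  shows "before (partial_sum \<delta> ` {1..n}) k = j"
    and "k \<in> partial_sum \<delta> ` {1..n} \<longleftrightarrow> k = partial_sum \<delta> (Suc j)"
proof -
  have low: "partial_sum \<delta> i \<le> partial_sum \<delta> j" if "i \<in> {1..j}" for i
    using partial_sum_less_iff[OF assms(1), of j i] that assms(2) by (auto simp: not_less[symmetric])
  have high: "partial_sum \<delta> (Suc j) \<le> partial_sum \<delta> i" if "i \<in> {Suc j..n}" for i
    using partial_sum_less_iff[OF assms(1), of i "Suc j"] that assms(2) by (auto simp: not_less[symmetric])
  have split: "{1..n} = {1..j} \<union> {Suc j..n}" using assms(2) by auto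
  have "partial_sum \<delta> ` {1..n} \<inter> {..<k} = partial_sum \<delta> ` {1..j}"
    unfolding split using low high assms(3) by fastforce
  moreover have "inj_on (partial_sum \<delta>) {1..j}"
    by (rule inj_on_subset[OF inj_on_partial_sum[OF assms(1)]]) (use assms(2) in auto)
  ultimately show "before (partial_sum \<delta> ` {1..n}) k = j" by (simp add: before_def card_image)
  show "k \<in> partial_sum \<delta> ` {1..n} \<longleftrightarrow> k = partial_sum \<delta> (Suc j)"
    unfolding split using low high assms(2,3) by (fastforce simp: split[symmetric])
qed

lemma Max_partial_sums:
  assumes "\<delta> \<in> gap_vectors n" "0 < n"
  shows "Max (partial_sum \<delta> ` {1..n}) = partial_sum \<delta> n"
  using partial_sum_less_iff[OF assms(1), of n] assms(2)
  by (intro Max_eqI) (auto simp: not_less[symmetric])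

section \<open>The product of geometric laws as a law on sets of tops\<close>

context multiqueue
begin

text \<open>The failure probability of the \<open>j\<close>-th geometric gap. For \<open>j\<close>
  in \<open>{1..<n}\<close>, the stability assumption says precisely that it is below 1.\<close>

definition ratio :: "nat \<Rightarrow> real" where
  "ratio j = real j / (real n * sigma_le \<sigma> j)"

lemma ratio_bounds: "j \<in> {1..<n} \<Longrightarrow> 0 < ratio j \<and> ratio j < 1"
  using stable[of j] sigma_le_pos[of j] n_pos by (auto simp: ratio_def field_simps)

definition gap_pmf :: "(nat \<Rightarrow> nat) pmf" where
  "gap_pmf = Pi_pmf {1..<n} 0 (\<lambda>j. geom1_pmf (1 - ratio j))"

definition stationary :: "nat set pmf" where
  "stationary = map_pmf (\<lambda>\<delta>. partial_sum \<delta> ` {1..n}) gap_pmf"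

lemma pmf_geom1: "j \<in> {1..<n} \<Longrightarrow> 0 < d \<Longrightarrow> pmf (geom1_pmf (1 - ratio j)) d = (1 - ratio j) * ratio j ^ (d - 1)"
  using pmf_map_inj'[OF inj_Suc, of "geometric_pmf (1 - ratio j)" "d - 1"] ratio_bounds[of j]
  by (simp add: geom1_pmf_def)

lemma set_gap_pmf: "set_pmf gap_pmf \<subseteq> gap_vectors n"
proof
  fix \<delta> assume "\<delta> \<in> set_pmf gap_pmf"
  then have *: "\<delta> \<in> PiE_dflt {1..<n} 0 (set_pmf \<circ> (\<lambda>j. geom1_pmf (1 - ratio j)))"
    unfolding gap_pmf_def by (rule subsetD[OF set_Pi_pmf_subset'[OF finite_atLeastLessThan]])
  then have "\<delta> j \<in> range Suc" if "j \<in> {1..<n}" for j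
    using that by (auto simp: PiE_dflt_def geom1_pmf_def)
  with * show "\<delta> \<in> gap_vectors n" by (fastforce simp: gap_vectors_def PiE_dflt_def)
qed

lemma set_stationary: "set_pmf stationary \<subseteq> top_sets n"
  using set_gap_pmf partial_sums_top_sets n_pos by (auto simp: stationary_def)

lemma mq_limit_eq: "mq_limit n \<sigma> = map_pmf (\<lambda>J. map Suc (sorted_list_of_set J)) stationary"
proof -
  have "map_pmf (\<lambda>J. map Suc (sorted_list_of_set J)) stationary
      = map_pmf (\<lambda>\<delta>. map Suc (sorted_list_of_set (partial_sum \<delta> ` {1..n}))) gap_pmf"
    by (simp add: stationary_def map_pmf_comp)
  also have "\<dots> = map_pmf (\<lambda>\<delta>. map (\<lambda>i. 1 + (\<Sum>j\<in>{1..<i}. \<delta> j)) [1..<n+1]) gap_pmf"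
    by (intro map_pmf_cong refl, subst sorted_list_of_partial_sums)
       (use set_gap_pmf in \<open>auto simp: partial_sum_def simp del: upt_Suc\<close>)
  finally show ?thesis by (simp add: mq_limit_def gap_pmf_def ratio_def)
qed

lemma pmf_stationary:
  assumes "\<delta> \<in> gap_vectors n"
  shows "pmf stationary (partial_sum \<delta> ` {1..n}) = (\<Prod>j\<in>{1..<n}. (1 - ratio j) * ratio j ^ (\<delta> j - 1))"
proof -
  have "pmf stationary (partial_sum \<delta> ` {1..n}) = measure_pmf.prob gap_pmf {\<delta>}"
    unfolding stationary_def pmf_map
    by (rule measure_pmf.finite_measure_eq_AE)
       (use set_gap_pmf partial_sum_eqD[OF _ assms] in \<open>auto simp: AE_measure_pmf_iff\<close>)
  also have "\<dots> = (\<Prod>j\<in>{1..<n}. pmf (geom1_pmf (1 - ratio j)) (\<delta> j))"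
    using assms unfolding gap_pmf_def measure_pmf_single by (intro pmf_Pi') (auto simp: gap_vectors_def)
  also have "\<dots> = (\<Prod>j\<in>{1..<n}. (1 - ratio j) * ratio j ^ (\<delta> j - 1))"
    using assms by (intro prod.cong refl pmf_geom1) (auto simp: gap_vectors_def)
  finally show ?thesis .
qed

section \<open>Law of the first appearances in a uniform sequence\<close>

lemma sets_prefix_pattern: "{b. \<forall>k<m. b k \<notin> b ` {..<k} \<longleftrightarrow> k \<in> J} \<in> sets labels"
proof -
  let ?G = "{xs. \<forall>k<m. xs ! k \<notin> set (take k xs) \<longleftrightarrow> k \<in> J}"
  have "(\<lambda>b. map b [0..<m]) \<in> labels \<rightarrow>\<^sub>M count_space UNIV"
    unfolding measurable_cong_sets[OF sets_iid refl]
    by (rule measurable_prefix[where g = "\<lambda>xs. xs"]) simp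
  then have "(\<lambda>b. map b [0..<m]) -` ?G \<inter> space labels \<in> sets labels"
    by (rule measurable_sets) simp
  also have "(\<lambda>b. map b [0..<m]) -` ?G \<inter> space labels = {b. \<forall>k<m. b k \<notin> b ` {..<k} \<longleftrightarrow> k \<in> J}"
    by (auto simp: take_map atLeast0LessThan min_def)
  finally show ?thesis .
qed

text \<open>The coupon collector computation: given the pattern before \<open>k\<close>, exactly
  \<open>before J k\<close> labels have been seen. A uniform label is therefore old in that many
  cases and new in the remaining ones.\<close>

lemma emeasure_prefix_pattern:
  "emeasure labels {b. \<forall>k<m. b k \<notin> b ` {..<k} \<longleftrightarrow> k \<in> J}
    = ennreal (\<Prod>k<m. real (if k \<in> J then n - before J k else before J k) / real n)"
proof (induction m)
  case 0
  interpret prob_space labels by (rule prob_space_iid)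
  show ?case using emeasure_space_1 by simp
next
  case (Suc m)
  define I where "I m b \<longleftrightarrow> (\<forall>k<m. b k \<notin> b ` {..<k} \<longleftrightarrow> k \<in> J)" for m and b :: "nat \<Rightarrow> nat"
  have sets: "{b. I m b} \<in> sets labels" for m
    unfolding I_def by (rule sets_prefix_pattern)
  let ?w = "real (if m \<in> J then n - before J m else before J m) / real n"
  have "emeasure labels {b. I (Suc m) b} = (\<integral>\<^sup>+b. indicator {b. I (Suc m) b} b \<partial>labels)"
    using sets by simp
  also have "\<dots> = (\<integral>\<^sup>+b. \<integral>\<^sup>+q. indicator {b. I (Suc m) b} (insert_at m q b) \<partial>pmf_of_set {1..n} \<partial>labels)"
    by (rule nn_integral_iid_insert_at) (use sets sets_iid in \<open>auto intro!: borel_measurable_indicator\<close>)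
  also have "\<dots> = (\<integral>\<^sup>+b. ennreal ?w * indicator {b. I m b} b \<partial>labels)"
  proof (rule nn_integral_cong_AE, use AE_recurrent in eventually_elim)
    fix b assume b: "recurrent n b"
    \<comment> \<open>Inserting at \<open>m\<close> leaves the first \<open>m\<close> entries alone,
      so the longer pattern is the shorter one together with a condition on the inserted
      label.\<close>
    have I: "I (Suc m) (insert_at m q b) \<longleftrightarrow> I m b \<and> (q \<notin> b ` {..<m} \<longleftrightarrow> m \<in> J)" for q
    proof -
      have "insert_at m q b ` {..<k} = b ` {..<k}" if "k \<le> m" for k
        using that by (auto simp: insert_at_def intro!: image_cong)
      then show ?thesis unfolding I_def All_less_Suc by (auto simp: insert_at_def)
    qed
    show "(\<integral>\<^sup>+q. indicator {b. I (Suc m) b} (insert_at m q b) \<partial>pmf_of_set {1..n}) = ennreal ?w * indicator {b. I m b} b"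
    proof (cases "I m b")
      case True
      have "first_positions n b \<inter> {..<m} = J \<inter> {..<m}"
        using True first_positions_iff[OF b] by (auto simp: I_def)
      then have "card (b ` {..<m}) = before J m"
        using before_first_positions[OF b, of m] by (simp add: before_def)
      moreover have "b ` {..<m} \<subseteq> {1..n}" using recurrent_range[OF b] by blast
      moreover have "{q \<in> {1..n}. q \<notin> b ` {..<m} \<longleftrightarrow> m \<in> J} = (if m \<in> J then {1..n} - b ` {..<m} else b ` {..<m})"
        using recurrent_range[OF b] by auto
      ultimately have "card {q \<in> {1..n}. q \<notin> b ` {..<m} \<longleftrightarrow> m \<in> J} = (if m \<in> J then n - before J m else before J m)"
        by (simp add: card_Diff_subset)
      moreover have "(\<integral>\<^sup>+q. indicator {b. I (Suc m) b} (insert_at m q b) \<partial>pmf_of_set {1..n})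
          = emeasure (measure_pmf (pmf_of_set {1..n})) {q. q \<notin> b ` {..<m} \<longleftrightarrow> m \<in> J}"
      proof -
        have "(\<lambda>q. indicator {b. I (Suc m) b} (insert_at m q b)) = (indicator {q. q \<notin> b ` {..<m} \<longleftrightarrow> m \<in> J} :: nat \<Rightarrow> ennreal)"
          using True by (auto simp: fun_eq_iff I indicator_def)
        then show ?thesis by (simp only:) (rule nn_integral_indicator, simp)
      qed
      moreover have "{1..n} \<inter> {q. q \<notin> b ` {..<m} \<longleftrightarrow> m \<in> J} = {q \<in> {1..n}. q \<notin> b ` {..<m} \<longleftrightarrow> m \<in> J}" by auto
      ultimately show ?thesis
        using True n_pos by (simp add: emeasure_pmf_of_set)
    qed (simp add: I)
  qed
  also have "\<dots> = ennreal ?w * emeasure labels {b. I m b}"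
    by (rule nn_integral_cmult_indicator[OF sets])
  also have "emeasure labels {b. I m b} = ennreal (\<Prod>k<m. real (if k \<in> J then n - before J k else before J k) / real n)"
    unfolding I_def by (rule Suc.IH)
  finally show ?case
    by (simp add: I_def ennreal_mult[symmetric] prod_nonneg mult.commute)
qed

text \<open>Agreement of the pattern up to \<open>Max J\<close> suffices: it gives one inclusion,
  and both sets have \<open>n\<close> elements.\<close>

lemma emeasure_first_positions:
  assumes J: "J \<in> top_sets n"
  shows "emeasure labels {b. first_positions n b = J}
    = ennreal (\<Prod>k\<le>Max J. real (if k \<in> J then n - before J k else before J k) / real n)"
proof -
  have fin: "finite J" "card J = n" using J by (auto simp: top_sets_def)
  have "emeasure labels {b. first_positions n b = J}
      = emeasure labels {b. \<forall>k<Suc (Max J). b k \<notin> b ` {..<k} \<longleftrightarrow> k \<in> J}"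
  proof (rule emeasure_eq_AE)
    show "AE b in labels. b \<in> {b. first_positions n b = J} \<longleftrightarrow> b \<in> {b. \<forall>k<Suc (Max J). b k \<notin> b ` {..<k} \<longleftrightarrow> k \<in> J}"
      using AE_recurrent
    proof eventually_elim
      fix b assume b: "recurrent n b"
      have "first_positions n b = J" if "\<forall>k<Suc (Max J). b k \<notin> b ` {..<k} \<longleftrightarrow> k \<in> J"
      proof -
        have "J \<subseteq> first_positions n b"
        proof
          fix k assume k: "k \<in> J"
          then have "k < Suc (Max J)" using fin by (simp add: less_Suc_eq_le)
          with k that show "k \<in> first_positions n b" unfolding first_positions_iff[OF b] by blast
        qed
        then show ?thesis
          using first_positions_top_sets[OF b] fin by (intro card_subset_eq[symmetric]) (auto simp: top_sets_def)
      qed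
      then show "b \<in> {b. first_positions n b = J} \<longleftrightarrow> b \<in> {b. \<forall>k<Suc (Max J). b k \<notin> b ` {..<k} \<longleftrightarrow> k \<in> J}"
        using first_positions_iff[OF b] by blast
    qed
    show "{b. first_positions n b = J} \<in> sets labels"
      using measurable_sets[OF measurable_first_positions[of n], of "{J}"] 
      by (simp add: sets_iid space_PiM vimage_def)
  qed (rule sets_prefix_pattern)
  then show ?thesis
    unfolding emeasure_prefix_pattern lessThan_Suc_atMost .
qed

text \<open>The integral of \<open>1 / weight (first_positions n b)\<close> over uniform sequences.
  Each gap contributes the factor of its closing new label, divided by the success probability of
  its geometric law.\<close>

definition normalizer :: real where
  "normalizer = (\<Prod>j\<in>{1..<n}. real (n - j) / (real n * sigma_le \<sigma> j * (1 - ratio j)))"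

lemma normalizer_pos: "0 < normalizer"
  unfolding normalizer_def using ratio_bounds sigma_le_pos n_pos by (intro prod_pos) auto

text \<open>With \<open>j\<close> labels seen, a position contributes \<open>ratio j\<close> if its
  label is old and \<open>(n - j) / (n * sigma_le \<sigma> j)\<close> if it is new. A gap consists
  of \<open>\<delta> j - 1\<close> old labels and then a new one, which is the shape of a geometric
  law up to a constant.\<close>

lemma first_positions_weighted_law:
  assumes J: "J \<in> top_sets n"
  shows "emeasure labels {b. first_positions n b = J} * ennreal (1 / weight J)
       = ennreal (normalizer * pmf stationary J)"
proof -
  obtain \<delta> where \<delta>: "\<delta> \<in> gap_vectors n" "J = partial_sum \<delta> ` {1..n}"
    using top_sets_partial_sums[OF J] .
  let ?e = "partial_sum \<delta>"
  define t where "t k = real (if k \<in> J then n - before J k else before J k) / (real n * sigma_le \<sigma> (before J k))" for k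
  have MJ: "Max J = ?e n" using \<delta> Max_partial_sums n_pos by simp
  have "(\<Prod>k\<le>Max J. real (if k \<in> J then n - before J k else before J k) / real n) * (1 / weight J)
      = (\<Prod>k=1..Max J. t k)"
  proof -
    \<comment> \<open>Position 0 always carries a new label and contributes
      \<open>n / n = 1\<close>, while \<open>weight\<close> starts at position 1.\<close>
    have "{..Max J} = insert 0 {1..Max J}" by auto
    then have "(\<Prod>k\<le>Max J. real (if k \<in> J then n - before J k else before J k) / real n)
        = (\<Prod>k=1..Max J. real (if k \<in> J then n - before J k else before J k) / real n)"
      using J n_pos by (simp add: top_sets_def)
    then show ?thesis
      by (simp add: weight_def t_def prod_dividef prod.distrib)
  qed
  also have "(\<Prod>k=1..Max J. t k) = (\<Prod>j\<in>{1..<n}. \<Prod>k\<in>{?e j<..?e (Suc j)}. t k)"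
    using prod_over_gaps[of t \<delta> "n - 1"] n_pos by (simp add: MJ)
  also have "\<dots> = (\<Prod>j\<in>{1..<n}. real (n - j) / (real n * sigma_le \<sigma> j) * ratio j ^ (\<delta> j - 1))"
  proof (rule prod.cong[OF refl])
    fix j assume j: "j \<in> {1..<n}"
    have pos: "0 < \<delta> j" using \<delta> j by (auto simp: gap_vectors_def)
    have "{?e j<..?e (Suc j)} = insert (?e (Suc j)) {?e j<..<?e (Suc j)}"
      using pos j by (auto simp: partial_sum_Suc)
    then have "(\<Prod>k\<in>{?e j<..?e (Suc j)}. t k) = t (?e (Suc j)) * (\<Prod>k\<in>{?e j<..<?e (Suc j)}. t k)"
      by simp
    also have "t (?e (Suc j)) = real (n - j) / (real n * sigma_le \<sigma> j)"
      using before_partial_sums[OF \<delta>(1) j, of "?e (Suc j)"] pos j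
      by (simp add: t_def \<delta>(2) partial_sum_Suc)
    also have "(\<Prod>k\<in>{?e j<..<?e (Suc j)}. t k) = (\<Prod>k\<in>{?e j<..<?e (Suc j)}. ratio j)"
      using before_partial_sums[OF \<delta>(1) j]
      by (intro prod.cong refl) (simp add: t_def \<delta>(2) ratio_def)
    also have "\<dots> = ratio j ^ (\<delta> j - 1)"
      using j by (simp add: partial_sum_Suc)
    finally show "(\<Prod>k\<in>{?e j<..?e (Suc j)}. t k) = real (n - j) / (real n * sigma_le \<sigma> j) * ratio j ^ (\<delta> j - 1)" .
  qed
  also have "\<dots> = normalizer * pmf stationary J"
    unfolding normalizer_def \<delta>(2) pmf_stationary[OF \<delta>(1)] prod.distrib[symmetric]
    by (intro prod.cong refl) (use ratio_bounds in \<open>force\<close>)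
  finally show ?thesis
    unfolding emeasure_first_positions[OF J]
    by (subst ennreal_mult[symmetric]) (auto intro!: prod_nonneg simp: weight_nonneg)
qed

text \<open>Both sides integrate against measures carried by the countable set
  \<open>top_sets n\<close>, so \<open>first_positions_weighted_law\<close> on single points is
  enough.\<close>

lemma nn_integral_weighted:
  "(\<integral>\<^sup>+b. \<phi> (first_positions n b) * ennreal (1 / weight (first_positions n b)) \<partial>labels)
   = ennreal normalizer * (\<integral>\<^sup>+J. \<phi> J \<partial>stationary)"
proof -
  let ?D = "distr labels (count_space UNIV) (first_positions n)"
  have meas: "first_positions n \<in> labels \<rightarrow>\<^sub>M count_space UNIV" by measurable
  have eq: "density ?D (\<lambda>J. ennreal (1 / weight J)) = density (measure_pmf stationary) (\<lambda>_. ennreal normalizer)"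
  proof (rule measure_eqI_countable_AE[OF _ _ _ _ countable_top_sets[of n]])
    show "AE J in density ?D (\<lambda>J. ennreal (1 / weight J)). J \<in> top_sets n"
      using AE_recurrent meas by (auto simp: AE_density AE_distr_iff elim!: eventually_mono intro: first_positions_top_sets)
    show "AE J in density (measure_pmf stationary) (\<lambda>_. ennreal normalizer). J \<in> top_sets n"
      using set_stationary by (auto simp: AE_density AE_measure_pmf_iff)
    fix J assume J: "J \<in> top_sets n"
    have "emeasure (density ?D (\<lambda>J. ennreal (1 / weight J))) {J} = ennreal (1 / weight J) * emeasure ?D {J}"
    proof -
      have "(\<lambda>I. ennreal (1 / weight I) * indicator {J} I) = (\<lambda>I. ennreal (1 / weight J) * indicator {J} I)"
        by (auto simp: indicator_def)
      then show ?thesis by (simp add: emeasure_density nn_integral_cmult_indicator)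
    qed
    also have "emeasure ?D {J} = emeasure labels {b. first_positions n b = J}"
      using meas by (subst emeasure_distr) (auto simp: space_PiM vimage_def)
    also have "ennreal (1 / weight J) * \<dots> = ennreal (normalizer * pmf stationary J)"
      using first_positions_weighted_law[OF J] by (simp add: mult.commute)
    also have "\<dots> = emeasure (density (measure_pmf stationary) (\<lambda>_. ennreal normalizer)) {J}"
      using normalizer_pos
      by (simp add: emeasure_density nn_integral_cmult_indicator emeasure_pmf_single ennreal_mult)
    finally show "emeasure (density ?D (\<lambda>J. ennreal (1 / weight J))) {J}
      = emeasure (density (measure_pmf stationary) (\<lambda>_. ennreal normalizer)) {J}" .
  qed simp_all
  have "(\<integral>\<^sup>+b. \<phi> (first_positions n b) * ennreal (1 / weight (first_positions n b)) \<partial>labels)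
      = (\<integral>\<^sup>+J. \<phi> J \<partial>density ?D (\<lambda>J. ennreal (1 / weight J)))"
    using meas by (simp add: nn_integral_density nn_integral_distr mult.commute)
  also have "\<dots> = ennreal normalizer * (\<integral>\<^sup>+J. \<phi> J \<partial>stationary)"
    unfolding eq by (simp add: nn_integral_density nn_integral_cmult)
  finally show ?thesis .
qed

text \<open>Deletion preserves total mass, that is, \<open>step_op\<close> fixes the constant 1.
  Adjointness tested against this constant, rewritten through \<open>nn_integral_weighted\<close>,
  is invariance under the reversed kernel.\<close>

lemma stationary_invariant: "bind_pmf stationary kernel = stationary"
proof -
  have eq: "(\<integral>\<^sup>+J. \<phi> J \<partial>bind_pmf stationary kernel) = (\<integral>\<^sup>+J. \<phi> J \<partial>stationary)" for \<phi>
  proof -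
    define \<psi> where "\<psi> J = \<phi> J * ennreal (1 / weight J)" for J
    have one: "step_op (\<lambda>_. 1) b = 1" for b
      using nn_integral_sigma[of "\<lambda>_. 1"] measure_pmf.emeasure_space_1[of \<sigma>] by (simp add: step_op_def)
    have "ennreal normalizer * (\<integral>\<^sup>+J. \<phi> J \<partial>bind_pmf stationary kernel)
        = (\<integral>\<^sup>+b. (\<integral>\<^sup>+I. \<phi> I \<partial>kernel (first_positions n b)) * ennreal (1 / weight (first_positions n b)) \<partial>labels)"
      unfolding nn_integral_bind_pmf by (rule nn_integral_weighted[symmetric])
    also have "\<dots> = (\<integral>\<^sup>+b. 1 * reverse_op \<psi> (first_positions n b) \<partial>labels)"
    proof (rule nn_integral_cong_AE, use AE_recurrent in eventually_elim)
      fix b assume b: "recurrent n b"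
      show "(\<integral>\<^sup>+I. \<phi> I \<partial>kernel (first_positions n b)) * ennreal (1 / weight (first_positions n b))
         = 1 * reverse_op \<psi> (first_positions n b)"
        by (subst reverse_op_kernel[OF first_positions_top_sets[OF b], of \<psi> \<phi>]) (auto simp: \<psi>_def)
    qed
    also have "\<dots> = (\<integral>\<^sup>+b. step_op (\<lambda>_. 1) b * \<psi> (first_positions n b) \<partial>labels)"
      by (rule step_op_adjoint[symmetric]) simp
    also have "\<dots> = ennreal normalizer * (\<integral>\<^sup>+J. \<phi> J \<partial>stationary)"
      unfolding one mult_1 \<psi>_def by (rule nn_integral_weighted)
    finally show ?thesis using normalizer_pos by (simp add: ennreal_mult_cancel_left)
  qed
  show ?thesis
  proof (rule pmf_eqI)
    fix J
    have "emeasure (measure_pmf (bind_pmf stationary kernel)) {J} = emeasure (measure_pmf stationary) {J}"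
      using eq[of "indicator {J}"] by (simp del: nn_integral_bind_pmf emeasure_bind_pmf)
    then show "pmf (bind_pmf stationary kernel) J = pmf stationary J"
      by (simp add: emeasure_pmf_single del: emeasure_bind_pmf)
  qed
qed

text \<open>The density after \<open>s\<close> deletions relative to the unnormalized stationary
  density \<open>1 / weight\<close>. The initial density is 1, which explains the starting value
  \<open>weight J\<close>, bounded by 1.\<close>

primrec relative_density :: "nat \<Rightarrow> nat set \<Rightarrow> real" where
  "relative_density 0 J = weight J"
| "relative_density (Suc s) J = measure_pmf.expectation (kernel J) (relative_density s)"

lemma relative_density_bounds: "0 \<le> relative_density s J" "relative_density s J \<le> 1"
proof -
  have "0 \<le> relative_density s J \<and> relative_density s J \<le> 1" for J
  proof (induction s arbitrary: J)
    case (Suc s)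
    have "integrable (measure_pmf (kernel J)) (relative_density s)"
      by (rule measure_pmf.integrable_const_bound[where B = 1]) (use Suc in auto)
    then show ?case
      using Suc by (auto intro!: integral_nonneg_AE measure_pmf.integral_le_const)
  qed (use weight_nonneg weight_le_1 in simp)
  then show "0 \<le> relative_density s J" "relative_density s J \<le> 1" by auto
qed

lemma reverse_op_iterate:
  "J \<in> top_sets n \<Longrightarrow>
     (reverse_op ^^ s) (\<lambda>_. 1) J = ennreal (relative_density s J) * ennreal (1 / weight J)"
proof (induction s arbitrary: J)
  case 0
  then show ?case using weight_pos[of J] by (simp add: ennreal_mult[symmetric])
next
  case (Suc s)
  have "integrable (measure_pmf (kernel J)) (relative_density s)"
    by (rule measure_pmf.integrable_const_bound[where B = 1]) (use relative_density_bounds in auto)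
  then have "(\<integral>\<^sup>+I. ennreal (relative_density s I) \<partial>kernel J) = ennreal (relative_density (Suc s) J)"
    using relative_density_bounds by (simp add: nn_integral_eq_integral)
  then show ?case
    using reverse_op_kernel[OF Suc.prems, of "(reverse_op ^^ s) (\<lambda>_. 1)" "\<lambda>I. ennreal (relative_density s I)"] Suc.IH
    by simp
qed

lemma nn_integral_ranks_stationary:
  "(\<integral>\<^sup>+\<omega>. g (mq_ranks n (fst \<circ> \<omega>) (snd \<circ> \<omega>) s) \<partial>mq_space n \<sigma>)
   = ennreal normalizer * (\<integral>\<^sup>+J. g (map Suc (sorted_list_of_set J)) * ennreal (relative_density s J) \<partial>stationary)"
proof -
  have "(\<integral>\<^sup>+\<omega>. g (mq_ranks n (fst \<circ> \<omega>) (snd \<circ> \<omega>) s) \<partial>mq_space n \<sigma>)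
     = (\<integral>\<^sup>+b. g (map Suc (sorted_list_of_set (first_positions n b)))
        * (reverse_op ^^ s) (\<lambda>_. 1) (first_positions n b) \<partial>labels)"
    by (rule nn_integral_mq_ranks)
  also have "\<dots> = (\<integral>\<^sup>+b. g (map Suc (sorted_list_of_set (first_positions n b)))
        * ennreal (relative_density s (first_positions n b)) * ennreal (1 / weight (first_positions n b)) \<partial>labels)"
    by (rule nn_integral_cong_AE, use AE_recurrent in eventually_elim)
       (simp add: reverse_op_iterate first_positions_top_sets mult.assoc)
  also have "\<dots> = ennreal normalizer * (\<integral>\<^sup>+J. g (map Suc (sorted_list_of_set J)) * ennreal (relative_density s J) \<partial>stationary)"
    by (rule nn_integral_weighted)
  finally show ?thesis .
qed

lemma relative_density_tendsto:
  assumes "J \<in> set_pmf stationary"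
  shows "(\<lambda>s. relative_density s J) \<longlonglongrightarrow> 1 / normalizer"
proof -
  have J: "J \<in> top_sets n" if "J \<in> set_pmf stationary" for J
    using that set_stationary by auto
  have "(\<lambda>s. relative_density s J) \<longlonglongrightarrow> measure_pmf.expectation stationary (relative_density 0)"
  proof (rule markov_iterates_converge[OF stationary_invariant, where C = 1 and U = "\<lambda>J. pushed J 0 (Max J)" and N = n and z = "{..<n}"])
    show "\<bar>relative_density 0 J\<bar> \<le> 1" for J using relative_density_bounds[of 0 J] by simp
  qed (use assms J flush_in_kernel flush_reaches_prefix in auto)
  \<comment> \<open>The limit is found from total mass: testing time 0 with the constant 1 shows
    that \<open>normalizer\<close> times the stationary mean of \<open>weight\<close> is 1.\<close>
  moreover have "measure_pmf.expectation stationary (relative_density 0) = 1 / normalizer"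
  proof -
    interpret prob_space "mq_space n \<sigma>"
      unfolding mq_space_def by (rule prob_space_iid)
    have "integrable (measure_pmf stationary) weight"
      by (rule measure_pmf.integrable_const_bound[where B = 1]) (use weight_nonneg weight_le_1 in auto)
    then have "(\<integral>\<^sup>+J. ennreal (weight J) \<partial>stationary) = ennreal (measure_pmf.expectation stationary weight)"
      using weight_nonneg by (intro nn_integral_eq_integral) auto
    then have "ennreal (normalizer * measure_pmf.expectation stationary weight) = 1"
      using nn_integral_ranks_stationary[of "\<lambda>_. 1" 0] emeasure_space_1 normalizer_pos
      by (simp add: ennreal_mult integral_nonneg_AE weight_nonneg)
    moreover have "relative_density 0 = weight" by (simp add: fun_eq_iff)
    ultimately show ?thesis using normalizer_pos by (simp add: field_simps)
  qed
  ultimately show ?thesis by simp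
qed

text \<open>The nonnegative formula, applied to indicators, identifies the law of the ranks; this
  transfers it to functions \<open>f\<close> of either sign.\<close>

lemma integral_ranks_stationary:
  fixes f :: "nat list \<Rightarrow> real"
  shows "(\<integral>\<omega>. f (mq_ranks n (fst \<circ> \<omega>) (snd \<circ> \<omega>) s) \<partial>mq_space n \<sigma>)
   = measure_pmf.expectation stationary (\<lambda>J. normalizer * relative_density s J * f (map Suc (sorted_list_of_set J)))"
proof -
  let ?R = "\<lambda>\<omega>. mq_ranks n (fst \<circ> \<omega>) (snd \<circ> \<omega>) s" and ?L = "\<lambda>J. map Suc (sorted_list_of_set J)"
  let ?D = "density (measure_pmf stationary) (\<lambda>J. ennreal (normalizer * relative_density s J))"
  have R: "?R \<in> mq_space n \<sigma> \<rightarrow>\<^sub>M count_space UNIV"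
    unfolding mq_space_def using measurable_mq_ranks[of n s] by (simp cong: measurable_cong_sets add: sets_iid)
  have "distr (mq_space n \<sigma>) (count_space UNIV) ?R = distr ?D (count_space UNIV) ?L"
  proof (rule measure_eqI)
    fix A :: "nat list set"
    have "emeasure (distr (mq_space n \<sigma>) (count_space UNIV) ?R) A = (\<integral>\<^sup>+\<omega>. indicator A (?R \<omega>) \<partial>mq_space n \<sigma>)"
      using R by (subst nn_integral_distr[symmetric]) auto
    also have "\<dots> = ennreal normalizer * (\<integral>\<^sup>+J. indicator A (?L J) * ennreal (relative_density s J) \<partial>stationary)"
      by (rule nn_integral_ranks_stationary)
    also have "\<dots> = (\<integral>\<^sup>+J. indicator A (?L J) \<partial>?D)"
      using normalizer_pos relative_density_bounds
      by (subst nn_integral_cmult[symmetric], simp, subst nn_integral_density)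
         (auto simp: ennreal_mult ac_simps)
    also have "\<dots> = emeasure (distr ?D (count_space UNIV) ?L) A"
      by (subst nn_integral_distr[of ?L ?D "count_space UNIV" "indicator A", symmetric]) auto
    finally show "emeasure (distr (mq_space n \<sigma>) (count_space UNIV) ?R) A = emeasure (distr ?D (count_space UNIV) ?L) A" .
  qed simp
  then have "(\<integral>\<omega>. f (?R \<omega>) \<partial>mq_space n \<sigma>) = (\<integral>J. f (?L J) \<partial>?D)"
    using integral_distr[OF R, of f] integral_distr[of ?L ?D "count_space UNIV" f] by simp
  also have "\<dots> = measure_pmf.expectation stationary (\<lambda>J. normalizer * relative_density s J * f (?L J))"
    using normalizer_pos relative_density_bounds by (subst integral_density) auto
  finally show ?thesis .
qed

text \<open>Lists carry the discrete topology, so convergence in distribution is tested with all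
  bounded \<open>f\<close>. The relative densities are at most 1, which supplies the dominating
  constant.\<close>

lemma ranks_converge:
  fixes f :: "nat list \<Rightarrow> real"
  assumes "bounded (range f)"
  shows "(\<lambda>s. \<integral>\<omega>. f (mq_ranks n (fst \<circ> \<omega>) (snd \<circ> \<omega>) s) \<partial>mq_space n \<sigma>)
      \<longlonglongrightarrow> measure_pmf.expectation (mq_limit n \<sigma>) f"
proof -
  obtain B where B: "\<And>x. \<bar>f x\<bar> \<le> B" using assms by (auto simp: bounded_iff)
  let ?L = "\<lambda>J. map Suc (sorted_list_of_set J)"
  have "(\<lambda>s. measure_pmf.expectation stationary (\<lambda>J. normalizer * relative_density s J * f (?L J)))
      \<longlonglongrightarrow> measure_pmf.expectation stationary (\<lambda>J. f (?L J))"
  proof (rule integral_dominated_convergence[where w = "\<lambda>_. normalizer * B"])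
    have "(\<lambda>s. normalizer * relative_density s J * f (?L J)) \<longlonglongrightarrow> f (?L J)" if "J \<in> set_pmf stationary" for J
    proof -
      have "(\<lambda>s. normalizer * relative_density s J * f (?L J)) \<longlonglongrightarrow> normalizer * (1 / normalizer) * f (?L J)"
        by (intro tendsto_intros relative_density_tendsto[OF that])
      then show ?thesis using normalizer_pos by simp
    qed
    then show "AE J in stationary. (\<lambda>s. normalizer * relative_density s J * f (?L J)) \<longlonglongrightarrow> f (?L J)"
      by (simp add: AE_measure_pmf_iff)
    fix s
    have "\<bar>normalizer * relative_density s J * f (?L J)\<bar> \<le> normalizer * B" for J
    proof -
      have "\<bar>normalizer * relative_density s J * f (?L J)\<bar> = normalizer * (relative_density s J * \<bar>f (?L J)\<bar>)"
        using normalizer_pos relative_density_bounds by (simp add: abs_mult)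
      also have "\<dots> \<le> normalizer * (1 * B)"
        using normalizer_pos relative_density_bounds B by (intro mult_left_mono mult_mono) auto
      finally show ?thesis by simp
    qed
    then show "AE J in stationary. norm (normalizer * relative_density s J * f (?L J)) \<le> normalizer * B" by simp
  qed auto
  then show ?thesis unfolding integral_ranks_stationary mq_limit_eq by simp
qed

end

theorem theorem1:
  fixes n :: nat and \<sigma> :: "nat pmf"
  assumes "set_pmf \<sigma> \<subseteq> {1..n}"
    and "\<And>i. i \<in> {1..<n} \<Longrightarrow> sigma_le \<sigma> i > real i / real n"
  shows "\<And>f :: nat list \<Rightarrow> real. bounded (range f) \<Longrightarrow>
    (\<lambda>s. \<integral>\<omega>. f (mq_ranks n (fst \<circ> \<omega>) (snd \<circ> \<omega>) s) \<partial>mq_space n \<sigma>)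
      \<longlonglongrightarrow> measure_pmf.expectation (mq_limit n \<sigma>) f"
proof -
  interpret multiqueue n \<sigma> by unfold_locales (use assms in auto)
  show "\<And>f :: nat list \<Rightarrow> real. bounded (range f) \<Longrightarrow>
    (\<lambda>s. \<integral>\<omega>. f (mq_ranks n (fst \<circ> \<omega>) (snd \<circ> \<omega>) s) \<partial>mq_space n \<sigma>)
      \<longlonglongrightarrow> measure_pmf.expectation (mq_limit n \<sigma>) f"
    by (rule ranks_converge)
qed

end
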